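(* Let $\mathcal{A}\in\mathbb{C}^{n\times n\times p}$ be a complex tensor with T-index $\mathrm{Ind}_T(\mathcal{A})=k$. For non-negative integers $m$ and $q$, the limit $$\lim_{z\to0}z^m(\mathcal{A}+z\mathcal{I})^{-1}*\mathcal{A}^q$$ exists if and only if $m+q\ge k$, in which case the limit is given by $$\lim_{z\to0}z^m(\mathcal{A}+z\mathcal{I})^{-1}*\mathcal{A}^q=\begin{cases}(-1)^{m+1}(\mathcal{I}-\mathcal{A}*\mathcal{A}^D)*\mathcal{A}^{m+q-1},& m>0,\\ \mathcal{A}^D*\mathcal{A}^q,& m=0.\end{cases}$$
   Context: For $\mathcal{A}\in\mathbb{C}^{m\times n\times p}$ let $A^{(1)},\dots,A^{(p)}\in\mathbb{C}^{m\times n}$ be its frontal slices. $\mathrm{bcirc}(\mathcal{A})$ is the $mp\times np$ block circulant matrix whose $(i,j)$ block ($1\le i,j\le p$) is $A^{(((i-j)\bmod p)+1)}$; $\mathrm{unfold}(\mathcal{A})$ is the $mp\times n$ matrix obtained by stacking $A^{(1)},\dots,A^{(p)}$ vertically, and $\mathrm{fold}$ is the inverse of $\mathrm{unfold}$. The T-product is $\mathcal{A}*\mathcal{B}=\mathrm{fold}(\mathrm{bcirc}(\mathcal{A})\,\mathrm{unfold}(\mathcal{B}))$; powers and inverses are with respect to $*$ and the identity tensor $\mathcal{I}$ (first frontal slice $I_n$, other slices zero), with $\mathcal{A}^0=\mathcal{I}$. The limit is over complex $z\ne0$ tending to $0$ (the inverse exists for all small $z\ne0$). The index $\mathrm{Ind}(A)$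 of a square matrix $A$ is the smallest nonnegative integer $k$ with $\mathrm{rank}(A^k)=\mathrm{rank}(A^{k+1})$ (so $\mathrm{Ind}(A)=0$ iff $A$ is invertible), and $\mathrm{Ind}_T(\mathcal{A})=\mathrm{Ind}(\mathrm{bcirc}(\mathcal{A}))$. The T-Drazin inverse $\mathcal{A}^D$ is the unique $\mathcal{X}\in\mathbb{C}^{n\times n\times p}$ with $\mathcal{A}^k*\mathcal{X}*\mathcal{A}=\mathcal{A}^k$, $\mathcal{X}*\mathcal{A}*\mathcal{X}=\mathcal{X}$, $\mathcal{A}*\mathcal{X}=\mathcal{X}*\mathcal{A}$, where $k=\mathrm{Ind}_T(\mathcal{A})$. *)

theory Defs
  imports Complex_Main "Jordan_Normal_Form.DL_Rank"
begin

text \<open>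
  A third-order tensor is the list of its frontal slices. Indices are 0-based, so \<open>A ! k\<close> is the
  (k+1)-st slice in the usual 1-based numbering. The dimensions can only be read off the tensor if it has at
  least one slice.
\<close>

type_synonym 'a tensor = "'a mat list"

definition carrier_tensor :: "nat \<Rightarrow> nat \<Rightarrow> nat \<Rightarrow> 'a tensor set" where
  "carrier_tensor m n p = {A. length A = p \<and> set A \<subseteq> carrier_mat m n}"

definition t_rows :: "'a tensor \<Rightarrow> nat" where
  "t_rows A = dim_row (hd A)"

definition t_cols :: "'a tensor \<Rightarrow> nat" where
  "t_cols A = dim_col (hd A)"

definition bcirc :: "'a tensor \<Rightarrow> 'a mat" where
  "bcirc A = (let m = t_rows A; n = t_cols A; p = length A in
     mat (m * p) (n * p)
       (\<lambda>(r, c). A ! nat ((int (r div m) - int (c div n)) mod int p) $$ (r mod m, c mod n)))"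

definition t_unfold :: "'a tensor \<Rightarrow> 'a mat" where
  "t_unfold A = (let m = t_rows A; n = t_cols A; p = length A in
     mat (m * p) n (\<lambda>(r, c). A ! (r div m) $$ (r mod m, c)))"

definition t_fold :: "nat \<Rightarrow> 'a mat \<Rightarrow> 'a tensor" where
  "t_fold p M = (let m = dim_row M div p; n = dim_col M in
     map (\<lambda>k. mat m n (\<lambda>(i, j). M $$ (k * m + i, j))) [0..<p])"

definition t_mult :: "'a :: semiring_0 tensor \<Rightarrow> 'a tensor \<Rightarrow> 'a tensor" (infixl \<open>*\<^sub>t\<close> 70) where
  "A *\<^sub>t B = t_fold (length A) (bcirc A * t_unfold B)"

definition t_add :: "'a :: plus tensor \<Rightarrow> 'a tensor \<Rightarrow> 'a tensor" (infixl \<open>+\<^sub>t\<close> 65) where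
  "A +\<^sub>t B = map2 (+) A B"

definition t_minus :: "'a :: minus tensor \<Rightarrow> 'a tensor \<Rightarrow> 'a tensor" (infixl \<open>-\<^sub>t\<close> 65) where
  "A -\<^sub>t B = map2 (-) A B"

definition t_smult :: "'a :: times \<Rightarrow> 'a tensor \<Rightarrow> 'a tensor" (infixr \<open>\<cdot>\<^sub>t\<close> 75) where
  "c \<cdot>\<^sub>t A = map (\<lambda>M. c \<cdot>\<^sub>m M) A"

definition t_one :: "nat \<Rightarrow> nat \<Rightarrow> 'a :: {zero, one} tensor" where
  "t_one n p = map (\<lambda>k. if k = 0 then 1\<^sub>m n else 0\<^sub>m n n) [0..<p]"

primrec t_pow :: "'a :: semiring_1 tensor \<Rightarrow> nat \<Rightarrow> 'a tensor" (infixr \<open>^\<^sub>t\<close> 80) where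
  "A ^\<^sub>t 0 = t_one (t_rows A) (length A)"
| "A ^\<^sub>t Suc k = A ^\<^sub>t k *\<^sub>t A"

definition t_inv :: "'a :: semiring_1 tensor \<Rightarrow> 'a tensor" where
  "t_inv A = (let n = t_rows A; p = length A in
     THE X. X \<in> carrier_tensor n n p \<and> A *\<^sub>t X = t_one n p \<and> X *\<^sub>t A = t_one n p)"

definition mat_index :: "'a :: field mat \<Rightarrow> nat" where
  "mat_index M = (LEAST k. vec_space.rank (dim_row M) (M ^\<^sub>m k) =
                           vec_space.rank (dim_row M) (M ^\<^sub>m (k + 1)))"

definition t_index :: "'a :: field tensor \<Rightarrow> nat" where
  "t_index A = mat_index (bcirc A)"

definition is_t_drazin :: "'a :: field tensor \<Rightarrow> 'a tensor \<Rightarrow> bool" where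
  "is_t_drazin A X \<longleftrightarrow>
     X \<in> carrier_tensor (t_rows A) (t_rows A) (length A) \<and>
     A ^\<^sub>t t_index A *\<^sub>t X *\<^sub>t A = A ^\<^sub>t t_index A \<and>
     X *\<^sub>t A *\<^sub>t X = X \<and>
     A *\<^sub>t X = X *\<^sub>t A"

definition t_drazin :: "'a :: field tensor \<Rightarrow> 'a tensor" where
  "t_drazin A = (THE X. is_t_drazin A X)"

text \<open>
  Convergence in the finite-dimensional space of complex tensors of the shape of \<open>L\<close>: the values
  eventually have that shape and converge entrywise.
\<close>

definition t_tendsto :: "('b \<Rightarrow> complex tensor) \<Rightarrow> complex tensor \<Rightarrow> 'b filter \<Rightarrow> bool" where
  "t_tendsto f L F \<longleftrightarrow>
     (\<forall>\<^sub>F z in F. f z \<in> carrier_tensor (t_rows L) (t_cols L) (length L)) \<and>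
     (\<forall>k < length L. \<forall>i < t_rows L. \<forall>j < t_cols L.
        ((\<lambda>z. f z ! k $$ (i, j)) \<longlongrightarrow> L ! k $$ (i, j)) F)"

lemma carrier_tensor_dims:
  assumes "A \<in> carrier_tensor m n p" "p > 0"
  shows "t_rows A = m" "t_cols A = n" "length A = p"
proof -
  from assms have "hd A \<in> set A" by (cases A) (auto simp: carrier_tensor_def)
  with assms show "t_rows A = m" "t_cols A = n" "length A = p"
    by (auto simp: carrier_tensor_def t_rows_def t_cols_def)
qed

lemma block_index_less:
  fixes i k m p :: nat
  assumes "i < m" "k < p"
  shows "k * m + i < m * p"
proof -
  have "k * m + i < (k + 1) * m" using assms by simp
  also have "\<dots> \<le> p * m" using assms by (intro mult_right_mono) auto
  finally show ?thesis by (simp add: mult.commute)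
qed

lemma bcirc_block:
  assumes "A \<in> carrier_tensor m n p" "a < p" "b < p" "i < m" "j < n"
  shows "bcirc A $$ (a * m + i, b * n + j) = A ! nat ((int a - int b) mod int p) $$ (i, j)"
  using assms block_index_less[of i m a p] block_index_less[of j n b p]
  by (simp add: bcirc_def carrier_tensor_dims[OF assms(1)])

lemma t_fold_unfold:
  assumes "A \<in> carrier_tensor m n p" "p > 0"
  shows "t_fold p (t_unfold A) = A"
proof (rule nth_equalityI)
  show "length (t_fold p (t_unfold A)) = length A"
    using assms by (simp add: t_fold_def Let_def carrier_tensor_dims)
  fix k assume "k < length (t_fold p (t_unfold A))"
  hence k: "k < p" by (simp add: t_fold_def Let_def)
  hence "A ! k \<in> carrier_mat m n" using assms by (auto simp: carrier_tensor_def)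
  thus "t_fold p (t_unfold A) ! k = A ! k"
    using assms k
    by (intro eq_matI)
       (auto simp: t_fold_def t_unfold_def Let_def carrier_tensor_dims[OF assms] block_index_less)
qed

lemma t_unfold_fold:
  assumes "M \<in> carrier_mat (m * p) n" "p > 0"
  shows "t_unfold (t_fold p M) = M"
proof -
  have c: "t_fold p M \<in> carrier_tensor m n p"
    using assms by (auto simp: t_fold_def carrier_tensor_def)
  have u: "t_unfold (t_fold p M) =
      mat (m * p) n (\<lambda>(r, c). t_fold p M ! (r div m) $$ (r mod m, c))"
    by (simp add: t_unfold_def carrier_tensor_dims[OF c assms(2)])
  have "t_unfold (t_fold p M) $$ (r, c) = M $$ (r, c)" if "r < m * p" "c < n" for r c
  proof -
    from that have "m > 0" by (cases m) auto
    moreover have "r div m < p"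
      using that by (simp add: less_mult_imp_div_less mult.commute)
    ultimately show ?thesis
      using that assms unfolding u by (simp add: t_fold_def)
  qed
  thus ?thesis using assms by (intro eq_matI) (auto simp: u)
qed

end

theory Submission
  imports "Jordan_Normal_Form.Char_Poly" Defs
begin

text \<open>
  Let \<open>D\<close> be the T-Drazin inverse of \<open>A\<close>, \<open>k\<close> its T-index, \<open>E = I - A D\<close> and \<open>R z = (A + z I)\<^sup>-\<^sup>1\<close>. The
  idempotents \<open>A D\<close> and \<open>E\<close> split the problem into an invertible and a nilpotent part, as for matrices:

  \<^item> \<open>R z * (A D) = D (I + z D)\<^sup>-\<^sup>1\<close>, which tends to \<open>D\<close> because inversion is continuous at \<open>I\<close> (\<open>core_part\<close>).
  \<^item> \<open>E A\<^sup>r = 0\<close> for \<open>r \<ge> k\<close>, and \<open>z R z = I - R z A\<close>. By induction on \<open>m\<close> the family \<open>z\<^sup>m R z E A\<^sup>r\<close> with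
    \<open>m + r \<ge> k\<close> tends to \<open>(- 1)\<^sup>m\<^sup>+\<^sup>1 E A\<^sup>m\<^sup>+\<^sup>r\<^sup>-\<^sup>1\<close> if \<open>m > 0\<close> and to \<open>0\<close> if \<open>m = 0\<close> (\<open>nilpotent_part\<close>).

  Adding both parts gives the limit when \<open>m + q \<ge> k\<close>. The converse follows from this formula: if
  \<open>z\<^sup>m R z A\<^sup>q\<close> converges with \<open>m + q < k\<close>, then \<open>z\<^sup>k\<^sup>-\<^sup>q R z A\<^sup>q\<close> tends both to \<open>0\<close> and to
  \<open>\<plusminus> E A\<^sup>k\<^sup>-\<^sup>1\<close>, so \<open>A\<^sup>k\<^sup>-\<^sup>1 = A\<^sup>k D\<close>, and the ranks of \<open>A\<^sup>k\<^sup>-\<^sup>1\<close> and \<open>A\<^sup>k\<close> agree, against the minimality of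
  \<open>k\<close> (\<open>index_le_if_limit\<close>).

  The existence of \<open>D\<close> has to be derived from the rank condition that defines the index. Equality of
  the ranks of the powers \<open>k\<close> and \<open>k + 1\<close> of \<open>bcirc A\<close> yields a factorization of the first through the
  second and a cancellation law, and in any monoid these two properties produce a Drazin inverse
  (\<open>drazin_inverse_exists\<close>). Tensors are handled through \<open>bcirc\<close>, an injective homomorphism into
  matrices, and through \<open>t_unfold\<close>, which turns left multiplication by a tensor into left
  multiplication by a matrix.
\<close>

section \<open>Rank and the index of a matrix\<close>

context vec_space begin

lemma fin_dim_col_space: "B \<in> carrier_mat n nc \<Longrightarrow> vectorspace.fin_dim class_ring (vs (col_space B))"
  unfolding col_space_def using fin_dim_span_cols by simp

lemma subspace_col_space: "B \<in> carrier_mat n nc \<Longrightarrow> subspace class_ring (col_space B) V"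
  unfolding col_space_def using cols_dim span_is_subspace by (metis carrier_matD(1))

lemma rank_col_space: "rank B = vectorspace.dim class_ring (vs (col_space B))"
  unfolding rank_def col_space_def ..

lemma col_space_mult_subset:
  assumes "B \<in> carrier_mat n nc" "X \<in> carrier_mat nc nd"
  shows "col_space (B * X) \<subseteq> col_space B"
  using assms unfolding col_space_eq[OF assms(1)] col_space_eq[OF mult_carrier_mat[OF assms]]
  by (auto intro!: bexI[of _ "X *\<^sub>v _"])

lemma dim_subspace_mono:
  assumes W: "subspace class_ring W V" "subspace class_ring W' V" "W \<subseteq> W'"
    and fd: "vectorspace.fin_dim class_ring (vs W)" "vectorspace.fin_dim class_ring (vs W')"
  shows "vectorspace.dim class_ring (vs W) \<le> vectorspace.dim class_ring (vs W')"
proof -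
  have "subspace class_ring W (vs W')"
    using nested_subspaces W by blast
  thus ?thesis
    using vectorspace.subspace_dim[OF subspace_is_vs[OF W(2)], of W] fd by simp
qed

text \<open>
  A basis of the smaller space is independent in the larger one and has at least as many elements as
  its dimension, so it spans that space too.
\<close>

lemma subspace_eq_if_dim_le:
  assumes W: "subspace class_ring W V" "subspace class_ring W' V" "W \<subseteq> W'"
    and fd: "vectorspace.fin_dim class_ring (vs W)" "vectorspace.fin_dim class_ring (vs W')"
    and le: "vectorspace.dim class_ring (vs W') \<le> vectorspace.dim class_ring (vs W)"
  shows "W = W'"
proof -
  interpret W: vectorspace class_ring "vs W" using subspace_is_vs[OF W(1)] .
  interpret W': vectorspace class_ring "vs W'" using subspace_is_vs[OF W(2)] .
  obtain b where b: "finite b" "W.basis b" using W.finite_basis_exists fd(1) by blast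
  hence bW: "b \<subseteq> W" and li: "W.lin_indpt b" and sp: "W.span b = W" unfolding W.basis_def by auto
  have sm: "submodule class_ring W V" "submodule class_ring W' V" using W by (simp_all)
  have li': "W'.lin_indpt b"
    using li span_li_not_depend(2)[OF bW sm(1)] span_li_not_depend(2)[OF _ sm(2), of b] bW W(3) by auto
  have "W'.basis b"
    using W'.dim_li_is_basis[OF fd(2) b(1) _ li'] bW W(3) W.dim_basis[OF b] le by auto
  hence "W'.span b = W'" unfolding W'.basis_def by auto
  thus ?thesis
    using sp span_li_not_depend(1)[OF bW sm(1)] span_li_not_depend(1)[OF _ sm(2), of b] bW W(3) by auto
qed

lemma rank_mult_le:
  assumes "B \<in> carrier_mat n nc" "X \<in> carrier_mat nc nd"
  shows "rank (B * X) \<le> rank B"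
  unfolding rank_col_space
  using dim_subspace_mono[of "col_space (B * X)" "col_space B"] col_space_mult_subset[OF assms]
    subspace_col_space[OF assms(1)] fin_dim_col_space[OF assms(1)]
    subspace_col_space[OF mult_carrier_mat[OF assms]] fin_dim_col_space[OF mult_carrier_mat[OF assms]]
  by blast

text \<open>
  Equal rank forces equal column spaces, so each column of \<open>B\<close> is some \<open>B * X *\<^sub>v y\<close>; the vectors \<open>y\<close>
  are the columns of \<open>Y\<close>.
\<close>

lemma factor_through_same_rank:
  assumes B: "B \<in> carrier_mat n nc" and X: "X \<in> carrier_mat nc nd" and rk: "rank (B * X) = rank B"
  obtains Y where "Y \<in> carrier_mat nd nc" "B = B * X * Y"
proof -
  have BX: "B * X \<in> carrier_mat n nd" using B X by simp
  have eq: "col_space (B * X) = col_space B"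
    using subspace_eq_if_dim_le[of "col_space (B * X)" "col_space B"] rk[unfolded rank_col_space]
      subspace_col_space fin_dim_col_space col_space_mult_subset[OF B X] BX B by auto
  have "\<exists>y\<in>carrier_vec nd. (B * X) *\<^sub>v y = col B j" if "j < nc" for j
  proof -
    have unit: "B *\<^sub>v unit_vec nc j = col B j"
      using B that by (intro eq_vecI) (auto simp: scalar_prod_right_unit)
    have "B *\<^sub>v unit_vec nc j \<in> col_space B"
      unfolding col_space_eq[OF B] using B by auto
    hence "col B j \<in> col_space (B * X)"
      using eq unit by simp
    thus ?thesis unfolding col_space_eq[OF BX] using BX X by auto
  qed
  then obtain y where y: "\<And>j. j < nc \<Longrightarrow> y j \<in> carrier_vec nd \<and> (B * X) *\<^sub>v y j = col B j"
    by metis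
  define Y where "Y = mat nd nc (\<lambda>(i, j). y j $ i)"
  have Y: "Y \<in> carrier_mat nd nc" by (simp add: Y_def)
  have colY: "col Y j = y j" if "j < nc" for j
    using y[OF that] that by (intro eq_vecI) (auto simp: Y_def)
  have "B = B * X * Y"
  proof (rule eq_matI)
    fix i j assume ij: "i < dim_row (B * X * Y)" "j < dim_col (B * X * Y)"
    hence i: "i < n" and j: "j < nc" using B Y by auto
    have "(B * X * Y) $$ (i, j) = ((B * X) *\<^sub>v col Y j) $ i"
      using i j BX Y by (subst index_mult_mat) auto
    thus "B $$ (i, j) = (B * X * Y) $$ (i, j)"
      using y[OF j] colY[OF j] i j B by simp
  qed (use B Y in auto)
  thus ?thesis using that Y by blast
qed

text \<open>
  Rank-nullity for the map \<open>w \<mapsto> A *\<^sub>v w\<close> restricted to the column space of \<open>B\<close>: its image is the column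
  space of \<open>A * B\<close>, which has the same dimension, so its kernel is trivial.
\<close>

lemma kernel_mult_same_rank:
  assumes A: "A \<in> carrier_mat n n" and B: "B \<in> carrier_mat n nc" and rk: "rank (A * B) = rank B"
    and v: "v \<in> carrier_vec nc" and ker: "A * B *\<^sub>v v = 0\<^sub>v n"
  shows "B *\<^sub>v v = 0\<^sub>v n"
proof -
  let ?W = "col_space B"
  have sub: "subspace class_ring ?W V" using subspace_col_space[OF B] .
  interpret W: vectorspace class_ring "vs ?W" using subspace_is_vs[OF sub] .
  have Wc: "?W \<subseteq> carrier_vec n" unfolding col_space_eq[OF B] using B by auto
  interpret T: linear_map class_ring "vs ?W" V "\<lambda>w. A *\<^sub>v w"
  proof
    show "(*\<^sub>v) A \<in> LinearCombinations.module_hom class_ring (vs ?W) V"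
      unfolding LinearCombinations.module_hom_def using Wc A
      by (auto simp: mult_add_distrib_mat_vec[of _ n n] mult_mat_vec subset_iff module_vec_simps)
  qed
  have im: "T.im = col_space (A * B)"
  proof -
    have "T.im = (\<lambda>w. A *\<^sub>v w) ` ?W" unfolding T.im_def by simp
    also have "\<dots> = col_space (A * B)"
      unfolding col_space_eq[OF B] col_space_eq[OF mult_carrier_mat[OF A B]] using A B
      by (auto simp: image_iff)
    finally show ?thesis .
  qed
  have dim0: "vectorspace.dim class_ring (vs T.ker) = 0"
    using T.rank_nullity fin_dim_col_space[OF B] rk im unfolding rank_col_space
    by simp
  interpret K: vectorspace class_ring "vs T.ker"
    using W.subspace_is_vs[OF T.kerT_is_subspace] by simp
  have li: "W.lin_indpt S" if "S \<subseteq> T.ker" "K.lin_indpt S" for S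
    using W.span_li_not_depend(2)[OF that(1)] T.kerT_is_subspace that(2) by simp
  have kerW: "T.ker \<subseteq> ?W" unfolding T.ker_def by auto
  \<comment> \<open>Rank-nullity gives dimension 0 for the kernel, but that number only means something once the
    kernel is known to have a finite basis.\<close>
  have "\<exists>S. finite S \<and> maximal S (\<lambda>S. S \<subseteq> T.ker \<and> K.lin_indpt S)"
  proof (rule maximal_exists)
    show "finite S \<and> card S \<le> W.dim" if "S \<subseteq> T.ker \<and> K.lin_indpt S" for S
      using W.li_le_dim[OF fin_dim_col_space[OF B], of S] li[of S] that kerW by auto
    show "{} \<subseteq> T.ker \<and> K.lin_indpt {}" using K.finite_lin_indpt2[of "{}"] by auto
  qed
  then obtain S where S: "finite S" "K.basis S" using K.max_li_is_basis by auto
  hence "S = {}" using K.dim_basis[OF S] dim0 by simp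
  hence "T.ker = K.span {}" using S(2) unfolding K.basis_def by simp
  hence ker0: "T.ker = {0\<^sub>v n}" using K.span_empty by (simp add: module_vec_simps)
  have "B *\<^sub>v v \<in> ?W" using v B unfolding col_space_eq[OF B] by auto
  moreover have "A *\<^sub>v (B *\<^sub>v v) = 0\<^sub>v n" using ker A B v by (simp add: assoc_mult_mat_vec)
  ultimately have "B *\<^sub>v v \<in> T.ker" unfolding T.ker_def by (simp add: module_vec_simps)
  thus ?thesis using ker0 by simp
qed

lemma cancel_mult_same_rank:
  assumes A: "A \<in> carrier_mat n n" and B: "B \<in> carrier_mat n nc" and rk: "rank (A * B) = rank B"
    and X: "X \<in> carrier_mat nc l" and Y: "Y \<in> carrier_mat nc l" and eq: "A * B * X = A * B * Y"
  shows "B * X = B * Y"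
proof -
  have AB: "A * B \<in> carrier_mat n nc" using A B by simp
  have "col (B * X) j = col (B * Y) j" if j: "j < l" for j
  proof -
    have v: "col X j \<in> carrier_vec nc" "col Y j \<in> carrier_vec nc" using X Y by auto
    have "A * B *\<^sub>v (col X j - col Y j) = A * B *\<^sub>v col X j - A * B *\<^sub>v col Y j"
      using mult_minus_distrib_mat_vec[OF AB v] .
    also have "\<dots> = col (A * B * X) j - col (A * B * Y) j"
      using col_mult2[OF AB X j] col_mult2[OF AB Y j] by simp
    also have "\<dots> = 0\<^sub>v n" using AB Y j unfolding eq by (intro minus_cancel_vec) auto
    finally have "B *\<^sub>v (col X j - col Y j) = 0\<^sub>v n"
      using kernel_mult_same_rank[OF A B rk] v by simp
    hence z: "B *\<^sub>v col X j - B *\<^sub>v col Y j = 0\<^sub>v n"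
      using mult_minus_distrib_mat_vec[OF B v] by simp
    show ?thesis
    proof (rule eq_vecI)
      fix i assume "i < dim_vec (col (B * Y) j)"
      hence i: "i < n" using B by simp
      have "(B *\<^sub>v col X j - B *\<^sub>v col Y j) $ i = 0" using z i by simp
      thus "col (B * X) j $ i = col (B * Y) j $ i"
        using i B unfolding col_mult2[OF B X j] col_mult2[OF B Y j] by simp
    qed (use B in auto)
  qed
  thus ?thesis using B X Y by (intro mat_col_eqI) auto
qed

end

lemma pow_mat_Suc2:
  assumes "M \<in> carrier_mat N N"
  shows "M ^\<^sub>m Suc k = M * M ^\<^sub>m k"
  using assms by (induction k) (auto simp: assoc_mult_mat[OF assms pow_carrier_mat[OF assms] assms])

text \<open>
  The ranks of the powers cannot decrease strictly forever, so the minimum in the definition of the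
  index is attained.
\<close>

lemma mat_index_rank:
  fixes M :: "'a :: field mat"
  assumes M: "M \<in> carrier_mat N N"
  shows "vec_space.rank N (M ^\<^sub>m Suc (mat_index M)) = vec_space.rank N (M ^\<^sub>m mat_index M)"
proof -
  interpret vec_space "TYPE('a)" N .
  have mono: "rank (M ^\<^sub>m Suc k) \<le> rank (M ^\<^sub>m k)" for k
    using rank_mult_le[OF pow_carrier_mat[OF M] M] by simp
  have "\<exists>k. rank (M ^\<^sub>m k) = rank (M ^\<^sub>m (k + 1))"
  proof (rule ccontr)
    assume "\<not> ?thesis"
    hence "rank (M ^\<^sub>m Suc k) < rank (M ^\<^sub>m k)" for k
      using mono[of k] by (metis Suc_eq_plus1 le_neq_implies_less)
    hence dec: "rank (M ^\<^sub>m Suc k) + 1 \<le> rank (M ^\<^sub>m k)" for k by (simp add: Suc_le_eq)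
    have "rank (M ^\<^sub>m k) + k \<le> rank (M ^\<^sub>m 0)" for k
    proof (induction k)
      case (Suc k)
      thus ?case using dec[of k] by linarith
    qed simp
    from this[of "Suc (rank (M ^\<^sub>m 0))"] show False by simp
  qed
  from LeastI_ex[OF this] show ?thesis using M by (simp add: mat_index_def)
qed

lemma mat_index_le:
  fixes M :: "'a :: field mat"
  assumes M: "M \<in> carrier_mat N N" and Y: "Y \<in> carrier_mat N N" and eq: "M ^\<^sub>m k = M ^\<^sub>m Suc k * Y"
  shows "mat_index M \<le> k"
proof -
  interpret vec_space "TYPE('a)" N .
  have "rank (M ^\<^sub>m Suc k) \<le> rank (M ^\<^sub>m k)"
    using rank_mult_le[OF pow_carrier_mat[OF M] M] by simp
  moreover have "rank (M ^\<^sub>m k) \<le> rank (M ^\<^sub>m Suc k)"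
    unfolding eq using rank_mult_le[OF pow_carrier_mat[OF M] Y] .
  ultimately show ?thesis
    unfolding mat_index_def using M by (intro Least_le) simp
qed

section \<open>Drazin inverses in monoids\<close>

definition (in monoid) drazin_inverse :: "nat \<Rightarrow> 'a \<Rightarrow> 'a \<Rightarrow> bool" where
  "drazin_inverse k a d \<longleftrightarrow> d \<in> carrier G \<and>
     a [^] k \<otimes> d \<otimes> a = a [^] k \<and> d \<otimes> a \<otimes> d = d \<and> a \<otimes> d = d \<otimes> a"

context monoid
begin

lemma nat_pow_commute:
  assumes "x \<in> carrier G" "y \<in> carrier G" "x \<otimes> y = y \<otimes> x"
  shows "x [^] (j::nat) \<otimes> y = y \<otimes> x [^] j"
proof (induction j)
  case (Suc j)
  have "x [^] Suc j \<otimes> y = x [^] j \<otimes> (y \<otimes> x)"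
    using assms by (simp add: m_assoc)
  also have "\<dots> = (y \<otimes> x [^] j) \<otimes> x"
    using assms Suc by (simp flip: m_assoc)
  finally show ?case using assms by (simp add: m_assoc)
qed (use assms in simp)

text \<open>
  Since \<open>d \<otimes> a\<close> is idempotent and the factors commute, \<open>d\<close> is divisible by \<open>a [^] k\<close> from both sides, and
  \<open>e \<otimes> a\<close> acts as an identity on \<open>a [^] k\<close>.
\<close>

lemma drazin_inverse_absorb:
  assumes a: "a \<in> carrier G" and d: "drazin_inverse k a d" and e: "drazin_inverse k a e"
  shows "d \<otimes> (e \<otimes> a) = d" "(e \<otimes> a) \<otimes> d = d"
proof -
  note D = d[unfolded drazin_inverse_def] and E = e[unfolded drazin_inverse_def]
  have dc: "d \<in> carrier G" "a \<otimes> d = d \<otimes> a" "d \<otimes> a \<otimes> d = d" 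
    and ec: "e \<in> carrier G" "a \<otimes> e = e \<otimes> a" "a [^] k \<otimes> e \<otimes> a = a [^] k" using D E by auto
  have dk: "d \<otimes> (d \<otimes> a) [^] j = d" "(d \<otimes> a) [^] j \<otimes> d = d" for j :: nat
  proof -
    have "d \<otimes> (d \<otimes> a) = d" using dc a by (metis m_assoc)
    then show "d \<otimes> (d \<otimes> a) [^] j = d"
      using dc(1) a by (induction j) (simp_all flip: m_assoc)
    show "(d \<otimes> a) [^] j \<otimes> d = d"
      using dc a by (induction j) (simp_all add: m_assoc)
  qed
  have pw: "(d \<otimes> a) [^] k = d [^] k \<otimes> a [^] k"  "(d \<otimes> a) [^] k = a [^] k \<otimes> d [^] k"
    using pow_mult_distrib[of d a k] pow_mult_distrib[of a d k] dc a by auto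
  have "a [^] k \<otimes> (e \<otimes> a) = a [^] k" using ec a by (simp add: m_assoc)
  moreover have "(e \<otimes> a) \<otimes> a [^] k = a [^] k"
    using calculation nat_pow_commute[of a "e \<otimes> a" k] ec(1) a arg_cong[OF ec(2), of "\<lambda>t. t \<otimes> a"]
    by (simp add: m_assoc)
  ultimately have "(d \<otimes> a) [^] k \<otimes> (e \<otimes> a) = (d \<otimes> a) [^] k" "(e \<otimes> a) \<otimes> (d \<otimes> a) [^] k = (d \<otimes> a) [^] k"
    using dc(1) ec(1) a by (simp add: pw(1) m_assoc, simp add: pw(2) flip: m_assoc)
  thus "d \<otimes> (e \<otimes> a) = d" "(e \<otimes> a) \<otimes> d = d"
    using dk[of k] dc(1) ec(1) a by (metis m_assoc m_closed nat_pow_closed)+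
qed

lemma drazin_inverse_unique:
  assumes a: "a \<in> carrier G" and d: "drazin_inverse k a d" and e: "drazin_inverse k a e"
  shows "d = e"
proof -
  have c: "d \<in> carrier G" "e \<in> carrier G" "a \<otimes> e = e \<otimes> a"
    using d e unfolding drazin_inverse_def by auto
  have "d = d \<otimes> (e \<otimes> a)" using drazin_inverse_absorb[OF a d e] by simp
  also have "\<dots> = d \<otimes> a \<otimes> e" using c a by (simp add: m_assoc)
  also have "\<dots> = e" using drazin_inverse_absorb[OF a e d] by simp
  finally show ?thesis .
qed

text \<open>
  One-sided information suffices: \<open>a [^] k\<close> is a right multiple of \<open>a [^] Suc k\<close>, and left
  multiplication by \<open>a [^] Suc k\<close> identifies no more elements than left multiplication by \<open>a [^] k\<close>.
  Both hypotheses extend to all higher powers of \<open>a\<close>. As \<open>x\<close> and \<open>a\<close> may fail to commute, the identities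
  for the candidate \<open>a [^] k \<otimes> x [^] Suc k\<close> are verified after multiplying them by such a power, which
  is then cancelled.
\<close>

lemma drazin_inverse_exists:
  assumes a: "a \<in> carrier G" and x: "x \<in> carrier G"
    and fac: "a [^] Suc k \<otimes> x = a [^] k"
    and cancel: "\<And>v w. v \<in> carrier G \<Longrightarrow> w \<in> carrier G \<Longrightarrow>
      a [^] Suc k \<otimes> v = a [^] Suc k \<otimes> w \<Longrightarrow> a [^] k \<otimes> v = a [^] k \<otimes> w"
  shows "drazin_inverse k a (a [^] k \<otimes> x [^] Suc k)"
proof -
  have fac': "a [^] (k + j) \<otimes> x [^] j = a [^] k" for j
  proof (induction j)
    case (Suc j)
    have "a [^] (k + Suc j) = a [^] j \<otimes> a [^] Suc k"
      using a nat_pow_mult[of a j "Suc k"] by (simp add: add.commute del: nat_pow_Suc Group.nat_pow_Suc)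
    hence "a [^] (k + Suc j) \<otimes> x [^] Suc j = a [^] j \<otimes> (a [^] Suc k \<otimes> x) \<otimes> x [^] j"
      using a x by (simp only: m_assoc nat_pow_Suc2 nat_pow_closed m_closed)
    also have "\<dots> = a [^] (k + j) \<otimes> x [^] j"
      using a x fac nat_pow_mult[of a j k] by (simp add: add.commute del: nat_pow_Suc Group.nat_pow_Suc)
    finally show ?case using Suc by simp
  qed (use a in simp)
  have cancel': "a [^] k \<otimes> v = a [^] k \<otimes> w"
    if "v \<in> carrier G" "w \<in> carrier G" "a [^] (k + j) \<otimes> v = a [^] (k + j) \<otimes> w" for j v w
    using that
  proof (induction j arbitrary: v w)
    case (Suc j)
    have split: "a [^] (k + Suc j) = a [^] Suc k \<otimes> a [^] j" "a [^] (k + j) = a [^] k \<otimes> a [^] j"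
      using a nat_pow_mult[of a "Suc k" j] nat_pow_mult[of a k j] by (simp_all del: nat_pow_Suc Group.nat_pow_Suc)
    have "a [^] Suc k \<otimes> (a [^] j \<otimes> v) = a [^] Suc k \<otimes> (a [^] j \<otimes> w)"
      using Suc.prems a unfolding split by (simp only: m_assoc nat_pow_closed)
    hence "a [^] k \<otimes> (a [^] j \<otimes> v) = a [^] k \<otimes> (a [^] j \<otimes> w)"
      using cancel[of "a [^] j \<otimes> v" "a [^] j \<otimes> w"] Suc.prems(1,2) a by blast
    hence "a [^] (k + j) \<otimes> v = a [^] (k + j) \<otimes> w"
      using Suc.prems(1,2) a unfolding split by (simp only: m_assoc nat_pow_closed)
    thus ?case by (rule Suc.IH[OF Suc.prems(1,2)])
  qed simp
  define d where "d = a [^] k \<otimes> x [^] Suc k"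
  have dc: "d \<in> carrier G" using a x by (simp add: d_def)
  have Sk: "a [^] (Suc k) = a \<otimes> a [^] k" by (rule nat_pow_Suc2[OF a])
  have ad: "a \<otimes> d = a [^] k \<otimes> x [^] k"
  proof -
    have "a \<otimes> d = (a [^] Suc k \<otimes> x) \<otimes> x [^] k"
      using a x by (simp add: d_def Sk m_assoc nat_pow_Suc2 del: nat_pow_Suc Group.nat_pow_Suc)
    thus ?thesis unfolding fac .
  qed
  have da: "d \<otimes> a = a [^] k \<otimes> x [^] k"
  proof -
    have "a [^] (k + Suc k) \<otimes> (x [^] Suc k \<otimes> a) = a [^] Suc k"
      using fac'[of "Suc k"] a x
      by (simp flip: m_assoc del: nat_pow_Suc Group.nat_pow_Suc add_Suc_right) (simp only: nat_pow_Suc)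
    moreover have "a [^] (k + Suc k) \<otimes> x [^] k = a [^] Suc k"
    proof -
      have "a [^] (k + Suc k) = a \<otimes> a [^] (k + k)" using nat_pow_Suc2[OF a] by simp
      thus ?thesis using fac'[of k] a x by (simp add: m_assoc Sk del: nat_pow_Suc Group.nat_pow_Suc)
    qed
    ultimately show ?thesis
      using cancel'[of "x [^] Suc k \<otimes> a" "x [^] k" "Suc k"] a x
      by (simp add: d_def m_assoc del: nat_pow_Suc Group.nat_pow_Suc add_Suc_right)
  qed
  have "a [^] (k + k) \<otimes> (x [^] k \<otimes> a [^] k) = a [^] (k + k) \<otimes> \<one>"
    using fac'[of k] a x by (simp add: nat_pow_mult flip: m_assoc)
  hence reg: "a [^] k \<otimes> (x [^] k \<otimes> a [^] k) = a [^] k"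
    using cancel'[of "x [^] k \<otimes> a [^] k" \<one> k] a x by simp
  have "d \<otimes> a \<otimes> d = a [^] k \<otimes> (x [^] k \<otimes> a [^] k) \<otimes> x [^] Suc k"
    unfolding da using a x by (simp add: d_def m_assoc)
  hence "d \<otimes> a \<otimes> d = d" using reg by (simp add: d_def)
  moreover have "a [^] k \<otimes> d \<otimes> a = a [^] k"
    using a x dc fac'[of k] da by (simp add: m_assoc nat_pow_mult[symmetric])
  ultimately show ?thesis using dc ad da unfolding drazin_inverse_def d_def[symmetric] by simp
qed

end

section \<open>The algebra of the T-product\<close>

lemma tensor_eqI:
  assumes "A \<in> carrier_tensor m n p" "B \<in> carrier_tensor m n p"
    and "\<And>a i j. a < p \<Longrightarrow> i < m \<Longrightarrow> j < n \<Longrightarrow> A ! a $$ (i, j) = B ! a $$ (i, j)"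
  shows "A = B"
proof (rule nth_equalityI)
  fix a assume "a < length A"
  hence a: "a < p" "A ! a \<in> carrier_mat m n" "B ! a \<in> carrier_mat m n"
    using assms(1,2) by (auto simp: carrier_tensor_def)
  thus "A ! a = B ! a" using assms(3) by (intro eq_matI) auto
qed (use assms in \<open>auto simp: carrier_tensor_def\<close>)

lemma carrier_tensor_nth: "A \<in> carrier_tensor m n p \<Longrightarrow> a < p \<Longrightarrow> A ! a \<in> carrier_mat m n"
  by (auto simp: carrier_tensor_def)

lemma carrier_tensorI:
  "length A = p \<Longrightarrow> (\<And>a. a < p \<Longrightarrow> A ! a \<in> carrier_mat m n) \<Longrightarrow> A \<in> carrier_tensor m n p"
  by (auto simp: carrier_tensor_def set_conv_nth)

lemma t_add_closed: "A \<in> carrier_tensor m n p \<Longrightarrow> B \<in> carrier_tensor m n p \<Longrightarrow> A +\<^sub>t B \<in> carrier_tensor m n p"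
  by (rule carrier_tensorI) (auto simp: t_add_def carrier_tensor_nth carrier_tensor_def)

lemma t_minus_closed:
  assumes "A \<in> carrier_tensor m n p" "B \<in> carrier_tensor m n p"
  shows "A -\<^sub>t B \<in> carrier_tensor m n p"
proof (rule carrier_tensorI)
  show "length (A -\<^sub>t B) = p" using assms by (simp add: t_minus_def carrier_tensor_def)
  show "(A -\<^sub>t B) ! a \<in> carrier_mat m n" if "a < p" for a
    using assms that carrier_tensor_nth[OF assms(1) that] carrier_tensor_nth[OF assms(2) that]
    by (simp add: t_minus_def carrier_tensor_def minus_carrier_mat)
qed

lemma t_smult_closed: "A \<in> carrier_tensor m n p \<Longrightarrow> c \<cdot>\<^sub>t A \<in> carrier_tensor m n p"
  by (rule carrier_tensorI) (auto simp: t_smult_def carrier_tensor_nth carrier_tensor_def)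

lemma t_one_closed: "t_one n p \<in> carrier_tensor n n p"
  by (rule carrier_tensorI) (auto simp: t_one_def)

lemma t_add_index:
  assumes "A \<in> carrier_tensor m n p" "B \<in> carrier_tensor m n p" "a < p" "i < m" "j < n"
  shows "(A +\<^sub>t B) ! a $$ (i, j) = A ! a $$ (i, j) + B ! a $$ (i, j)"
  using assms carrier_tensor_nth[OF assms(1,3)] carrier_tensor_nth[OF assms(2,3)]
  by (auto simp: t_add_def carrier_tensor_def)

lemma t_minus_index:
  assumes "A \<in> carrier_tensor m n p" "B \<in> carrier_tensor m n p" "a < p" "i < m" "j < n"
  shows "(A -\<^sub>t B) ! a $$ (i, j) = A ! a $$ (i, j) - B ! a $$ (i, j)"
  using assms carrier_tensor_nth[OF assms(1,3)] carrier_tensor_nth[OF assms(2,3)]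
  by (auto simp: t_minus_def carrier_tensor_def)

lemma t_smult_index:
  assumes "A \<in> carrier_tensor m n p" "a < p" "i < m" "j < n"
  shows "(c \<cdot>\<^sub>t A) ! a $$ (i, j) = c * A ! a $$ (i, j)"
  using assms carrier_tensor_nth[OF assms(1,2)]
  by (auto simp: t_smult_def carrier_tensor_def)

lemma t_one_index:
  assumes "a < p" "i < n" "j < n"
  shows "t_one n p ! a $$ (i, j) = (if a = 0 \<and> i = j then 1 else 0)"
  using assms by (auto simp: t_one_def)

lemma bcirc_closed: "A \<in> carrier_tensor m n p \<Longrightarrow> p > 0 \<Longrightarrow> bcirc A \<in> carrier_mat (m * p) (n * p)"
  by (simp add: bcirc_def carrier_tensor_dims)

lemma t_unfold_closed: "A \<in> carrier_tensor m n p \<Longrightarrow> p > 0 \<Longrightarrow> t_unfold A \<in> carrier_mat (m * p) n"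
  by (simp add: t_unfold_def carrier_tensor_dims)

lemma t_unfold_index:
  assumes "A \<in> carrier_tensor m n p" "a < p" "i < m" "j < n"
  shows "t_unfold A $$ (a * m + i, j) = A ! a $$ (i, j)"
proof -
  have "p > 0" using assms by simp
  thus ?thesis using assms block_index_less[of i m a p]
    by (simp add: t_unfold_def carrier_tensor_dims[OF assms(1)])
qed

lemma t_fold_closed: "M \<in> carrier_mat (m * p) n \<Longrightarrow> p > 0 \<Longrightarrow> t_fold p M \<in> carrier_tensor m n p"
  by (auto simp: t_fold_def carrier_tensor_def)

lemma t_fold_index:
  assumes "M \<in> carrier_mat (m * p) n" "a < p" "i < m" "j < n"
  shows "t_fold p M ! a $$ (i, j) = M $$ (a * m + i, j)"
  using assms by (simp add: t_fold_def)

lemma t_unfold_inject: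
  assumes "A \<in> carrier_tensor m n p" "B \<in> carrier_tensor m n p" "p > 0" "t_unfold A = t_unfold B"
  shows "A = B"
  using t_fold_unfold[OF assms(1,3)] t_fold_unfold[OF assms(2,3)] assms(4) by metis

lemma t_mult_closed:
  assumes "A \<in> carrier_tensor m n p" "B \<in> carrier_tensor n l p" "p > 0"
  shows "A *\<^sub>t B \<in> carrier_tensor m l p"
proof -
  have "length A = p" using carrier_tensor_dims(3)[OF assms(1,3)] .
  thus ?thesis unfolding t_mult_def
    using t_fold_closed[OF mult_carrier_mat[OF bcirc_closed[OF assms(1,3)] t_unfold_closed[OF assms(2,3)]]] assms by simp
qed

lemma t_unfold_mult:
  assumes "A \<in> carrier_tensor m n p" "B \<in> carrier_tensor n l p" "p > 0"
  shows "t_unfold (A *\<^sub>t B) = bcirc A * t_unfold B"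
proof -
  have "length A = p" using carrier_tensor_dims(3)[OF assms(1,3)] .
  thus ?thesis unfolding t_mult_def
    using t_unfold_fold[OF mult_carrier_mat[OF bcirc_closed[OF assms(1,3)] t_unfold_closed[OF assms(2,3)]]] assms by simp
qed

lemma sum_blocks:
  fixes f :: "nat \<Rightarrow> 'a :: comm_monoid_add"
  shows "(\<Sum>r<n * p. f r) = (\<Sum>c<p. \<Sum>s<n. f (c * n + s))"
proof -
  have "(\<Sum>r<p * n. f r) = (\<Sum>c<p. sum f {c * n..<c * n + n})"
    by (rule sum.nat_group[symmetric])
  also have "\<dots> = (\<Sum>c<p. \<Sum>s<n. f (c * n + s))"
  proof (rule sum.cong[OF refl])
    show "sum f {c * n..<c * n + n} = (\<Sum>s<n. f (c * n + s))" for c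
      using sum.shift_bounds_nat_ivl[of f 0 "c * n" n] by (simp add: add.commute lessThan_atLeast0)
  qed
  finally show ?thesis by (simp add: mult.commute)
qed

lemma t_mult_index:
  assumes A: "A \<in> carrier_tensor m n p" and B: "B \<in> carrier_tensor n l p" and a: "a < p" "i < m" "j < l"
  shows "(A *\<^sub>t B) ! a $$ (i, j) =
    (\<Sum>c<p. \<Sum>s<n. A ! nat ((int a - int c) mod int p) $$ (i, s) * B ! c $$ (s, j))"
proof -
  have p: "p > 0" using a by simp
  have M: "bcirc A * t_unfold B \<in> carrier_mat (m * p) l"
    using mult_carrier_mat[OF bcirc_closed[OF A p] t_unfold_closed[OF B p]] .
  have "(A *\<^sub>t B) ! a $$ (i, j) = (bcirc A * t_unfold B) $$ (a * m + i, j)"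
    using t_fold_index[OF M a] carrier_tensor_dims(3)[OF A p] by (simp add: t_mult_def)
  also have "\<dots> = (\<Sum>r<n * p. bcirc A $$ (a * m + i, r) * t_unfold B $$ (r, j))"
    using bcirc_closed[OF A p] t_unfold_closed[OF B p] a block_index_less[of i m a p]
    by (simp add: scalar_prod_def lessThan_atLeast0)
  also have "\<dots> = (\<Sum>c<p. \<Sum>s<n. A ! nat ((int a - int c) mod int p) $$ (i, s) * B ! c $$ (s, j))"
    unfolding sum_blocks using a
    by (intro sum.cong refl) (simp add: bcirc_block[OF A] t_unfold_index[OF B])
  finally show ?thesis .
qed

lemma block_mat_eqI:
  assumes "M \<in> carrier_mat (m * p) (n * p)" "N \<in> carrier_mat (m * p) (n * p)"
    and "\<And>a b i j. a < p \<Longrightarrow> b < p \<Longrightarrow> i < m \<Longrightarrow> j < n \<Longrightarrow>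
      M $$ (a * m + i, b * n + j) = N $$ (a * m + i, b * n + j)"
  shows "M = N"
proof (rule eq_matI)
  fix r c assume "r < dim_row N" "c < dim_col N"
  hence rc: "r < m * p" "c < n * p" using assms by auto
  hence "m > 0" "n > 0" by (auto intro!: gr0I)
  moreover have "r div m < p" "c div n < p" using rc by (auto simp: less_mult_imp_div_less mult.commute)
  ultimately show "M $$ (r, c) = N $$ (r, c)"
    using assms(3)[of "r div m" "c div n" "r mod m" "c mod n"] by simp
qed (use assms in auto)

lemma nat_mod_less: "p > 0 \<Longrightarrow> nat (x mod int p) < p"
  by (simp add: nat_less_iff)

lemma sum_shift_mod:
  fixes f :: "nat \<Rightarrow> 'a :: comm_monoid_add"
  assumes "p > 0"
  shows "(\<Sum>d<p. f (nat ((int d - int b) mod int p))) = (\<Sum>c<p. f c)"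
proof (rule sum.reindex_bij_witness[where i = "\<lambda>c. nat ((int c + int b) mod int p)"
        and j = "\<lambda>d. nat ((int d - int b) mod int p)"])
  fix d assume "d \<in> {..<p}"
  thus "nat ((int (nat ((int d - int b) mod int p)) + int b) mod int p) = d"
    using assms by (simp add: mod_add_left_eq)
next
  fix c assume "c \<in> {..<p}"
  thus "nat ((int (nat ((int c + int b) mod int p)) - int b) mod int p) = c"
    using assms by (simp add: mod_diff_left_eq)
qed (use assms nat_mod_less in auto)

text \<open>
  The T-product is circular convolution of the frontal slices, so \<open>bcirc\<close> is multiplicative. As it is also
  injective, associativity and the unit laws below are inherited from matrices.
\<close>

lemma bcirc_mult:
  assumes A: "A \<in> carrier_tensor m n p" and B: "B \<in> carrier_tensor n l p" and p: "p > 0"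
  shows "bcirc (A *\<^sub>t B) = bcirc A * bcirc B"
proof (rule block_mat_eqI)
  show "bcirc (A *\<^sub>t B) \<in> carrier_mat (m * p) (l * p)" using bcirc_closed[OF t_mult_closed[OF A B p] p] .
  show "bcirc A * bcirc B \<in> carrier_mat (m * p) (l * p)"
    using mult_carrier_mat[OF bcirc_closed[OF A p] bcirc_closed[OF B p]] .
  fix a b i j assume ab: "a < p" "b < p" and ij: "i < m" "j < l"
  let ?g = "\<lambda>x. nat (x mod int p)"
  let ?f = "\<lambda>c. \<Sum>s<n. A ! ?g (int a - int b - int c) $$ (i, s) * B ! c $$ (s, j)"
  have "bcirc (A *\<^sub>t B) $$ (a * m + i, b * l + j) = (A *\<^sub>t B) ! ?g (int a - int b) $$ (i, j)"
    using bcirc_block[OF t_mult_closed[OF A B p] ab ij] .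
  also have "\<dots> = (\<Sum>c<p. ?f c)"
    using t_mult_index[OF A B nat_mod_less[OF p] ij] p by (simp add: mod_diff_left_eq)
  also have "\<dots> = (\<Sum>d<p. ?f (?g (int d - int b)))" by (rule sum_shift_mod[OF p, symmetric])
  also have "\<dots> = (\<Sum>d<p. \<Sum>s<n. bcirc A $$ (a * m + i, d * n + s) * bcirc B $$ (d * n + s, b * l + j))"
    using p ab ij by (intro sum.cong refl)
      (simp add: bcirc_block[OF A] bcirc_block[OF B] mod_diff_right_eq)
  also have "\<dots> = (\<Sum>r<n * p. bcirc A $$ (a * m + i, r) * bcirc B $$ (r, b * l + j))"
    by (rule sum_blocks[symmetric])
  also have "\<dots> = (bcirc A * bcirc B) $$ (a * m + i, b * l + j)"
    using bcirc_closed[OF A p] bcirc_closed[OF B p] block_index_less[OF ij(1) ab(1)] block_index_less[OF ij(2) ab(2)]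
    by (simp add: scalar_prod_def lessThan_atLeast0)
  finally show "bcirc (A *\<^sub>t B) $$ (a * m + i, b * l + j) = (bcirc A * bcirc B) $$ (a * m + i, b * l + j)" .
qed

lemma bcirc_inject:
  assumes A: "A \<in> carrier_tensor m n p" and B: "B \<in> carrier_tensor m n p" and p: "p > 0"
    and eq: "bcirc A = bcirc B"
  shows "A = B"
proof (rule tensor_eqI[OF A B])
  fix a i j assume "a < p" "i < m" "j < n"
  thus "A ! a $$ (i, j) = B ! a $$ (i, j)"
    using bcirc_block[OF A, of a 0 i j] bcirc_block[OF B, of a 0 i j] p eq by simp
qed

lemma bcirc_one: 
  assumes p: "p > 0"
  shows "bcirc (t_one n p :: 'a :: {zero, one} tensor) = 1\<^sub>m (n * p)"
proof (rule block_mat_eqI)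
  show "bcirc (t_one n p :: 'a tensor) \<in> carrier_mat (n * p) (n * p)" using bcirc_closed[OF t_one_closed p] .
  fix a b i j assume ab: "a < p" "b < p" and ij: "i < n" "j < n"
  have "nat ((int a - int b) mod int p) = 0 \<longleftrightarrow> a = b"
  proof
    assume "nat ((int a - int b) mod int p) = 0"
    hence "(int a - int b) mod int p = 0"
      using p pos_mod_sign[of "int p" "int a - int b"] by linarith
    hence "int a mod int p = int b mod int p" by (simp only: mod_eq_dvd_iff dvd_eq_mod_eq_0)
    thus "a = b" using ab by simp
  qed simp
  moreover have "a * n + i = b * n + j \<longleftrightarrow> a = b \<and> i = j"
  proof
    assume eq: "a * n + i = b * n + j"
    have "(a * n + i) div n = a" "(b * n + j) div n = b" using ij by simp_all
    hence "a = b" using eq by simp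
    thus "a = b \<and> i = j" using eq by simp
  qed simp
  ultimately show "bcirc (t_one n p :: 'a tensor) $$ (a * n + i, b * n + j) = 1\<^sub>m (n * p) $$ (a * n + i, b * n + j)"
    using ab ij p block_index_less[of i n a p] block_index_less[of j n b p]
    by (simp add: bcirc_block[OF t_one_closed] t_one_index nat_mod_less)
qed simp

lemma t_mult_assoc:
  fixes A B C :: "'a :: semiring_0 tensor"
  assumes A: "A \<in> carrier_tensor m n p" and B: "B \<in> carrier_tensor n l p" and C: "C \<in> carrier_tensor l q p"
    and p: "p > 0"
  shows "A *\<^sub>t B *\<^sub>t C = A *\<^sub>t (B *\<^sub>t C)"
proof (rule bcirc_inject[OF _ _ p])
  show "A *\<^sub>t B *\<^sub>t C \<in> carrier_tensor m q p" "A *\<^sub>t (B *\<^sub>t C) \<in> carrier_tensor m q p"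
    using assms by (auto intro: t_mult_closed)
  show "bcirc (A *\<^sub>t B *\<^sub>t C) = bcirc (A *\<^sub>t (B *\<^sub>t C))"
    using bcirc_mult[OF t_mult_closed[OF A B p] C p] bcirc_mult[OF A t_mult_closed[OF B C p] p]
      bcirc_mult[OF A B p] bcirc_mult[OF B C p]
      assoc_mult_mat[OF bcirc_closed[OF A p] bcirc_closed[OF B p] bcirc_closed[OF C p]] by simp
qed

lemma t_mult_one:
  fixes A :: "'a :: semiring_1 tensor"
  assumes A: "A \<in> carrier_tensor m n p" and p: "p > 0"
  shows "A *\<^sub>t t_one n p = A" "t_one m p *\<^sub>t A = A"
proof -
  show "A *\<^sub>t t_one n p = A"
    by (rule bcirc_inject[OF t_mult_closed[OF A t_one_closed p] A p])
      (use bcirc_closed[OF A p] in \<open>simp add: bcirc_mult[OF A t_one_closed p] bcirc_one[OF p]\<close>)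
  show "t_one m p *\<^sub>t A = A"
    by (rule bcirc_inject[OF t_mult_closed[OF t_one_closed A p] A p])
      (use bcirc_closed[OF A p] in \<open>simp add: bcirc_mult[OF t_one_closed A p] bcirc_one[OF p]\<close>)
qed

lemma t_add_mult_distrib:
  fixes A B C :: "'a :: ring tensor"
  assumes p: "p > 0" and A: "A \<in> carrier_tensor m n p" and B: "B \<in> carrier_tensor m n p" and C: "C \<in> carrier_tensor n l p"
  shows "(A +\<^sub>t B) *\<^sub>t C = A *\<^sub>t C +\<^sub>t B *\<^sub>t C" "(A -\<^sub>t B) *\<^sub>t C = A *\<^sub>t C -\<^sub>t B *\<^sub>t C"
proof -
  note AC = t_mult_closed[OF A C p] and BC = t_mult_closed[OF B C p]
  show "(A +\<^sub>t B) *\<^sub>t C = A *\<^sub>t C +\<^sub>t B *\<^sub>t C"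
    using t_add_closed[OF A B] t_add_closed[OF AC BC] p
    by (intro tensor_eqI[of _ m l p] t_mult_closed[OF _ C])
      (auto simp: t_mult_index[OF t_add_closed[OF A B] C] t_mult_index[OF A C] t_mult_index[OF B C] t_add_index[OF AC BC] t_add_index[OF A B] nat_mod_less A B
        sum.distrib distrib_right)
  show "(A -\<^sub>t B) *\<^sub>t C = A *\<^sub>t C -\<^sub>t B *\<^sub>t C"
    using t_minus_closed[OF A B] t_minus_closed[OF AC BC] p
    by (intro tensor_eqI[of _ m l p] t_mult_closed[OF _ C])
      (auto simp: t_mult_index[OF t_minus_closed[OF A B] C] t_mult_index[OF A C] t_mult_index[OF B C] t_minus_index[OF AC BC] t_minus_index[OF A B] nat_mod_less A B
        sum_subtractf left_diff_distrib)
qed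

lemma t_mult_add_distrib:
  fixes A B C :: "'a :: ring tensor"
  assumes p: "p > 0" and A: "A \<in> carrier_tensor m n p" and B: "B \<in> carrier_tensor n l p" and C: "C \<in> carrier_tensor n l p"
  shows "A *\<^sub>t (B +\<^sub>t C) = A *\<^sub>t B +\<^sub>t A *\<^sub>t C" "A *\<^sub>t (B -\<^sub>t C) = A *\<^sub>t B -\<^sub>t A *\<^sub>t C"
proof -
  note AB = t_mult_closed[OF A B p] and AC = t_mult_closed[OF A C p]
  show "A *\<^sub>t (B +\<^sub>t C) = A *\<^sub>t B +\<^sub>t A *\<^sub>t C"
    using t_add_closed[OF B C] t_add_closed[OF AB AC] p
    by (intro tensor_eqI[of _ m l p] t_mult_closed[OF A])
      (auto simp: t_mult_index[OF A t_add_closed[OF B C]] t_mult_index[OF A B] t_mult_index[OF A C] t_add_index[OF AB AC] t_add_index[OF B C] B C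
        sum.distrib distrib_left)
  show "A *\<^sub>t (B -\<^sub>t C) = A *\<^sub>t B -\<^sub>t A *\<^sub>t C"
    using t_minus_closed[OF B C] t_minus_closed[OF AB AC] p
    by (intro tensor_eqI[of _ m l p] t_mult_closed[OF A])
      (auto simp: t_mult_index[OF A t_minus_closed[OF B C]] t_mult_index[OF A B] t_mult_index[OF A C] t_minus_index[OF AB AC] t_minus_index[OF B C] B C
        sum_subtractf right_diff_distrib)
qed

lemma t_smult_mult:
  fixes A B :: "'a :: comm_semiring_0 tensor"
  assumes p: "p > 0" and A: "A \<in> carrier_tensor m n p" and B: "B \<in> carrier_tensor n l p"
  shows "(c \<cdot>\<^sub>t A) *\<^sub>t B = c \<cdot>\<^sub>t (A *\<^sub>t B)" "A *\<^sub>t (c \<cdot>\<^sub>t B) = c \<cdot>\<^sub>t (A *\<^sub>t B)"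
proof -
  note AB = t_mult_closed[OF A B p]
  show "(c \<cdot>\<^sub>t A) *\<^sub>t B = c \<cdot>\<^sub>t (A *\<^sub>t B)"
    using t_smult_closed[OF A] t_smult_closed[OF AB] p
    by (intro tensor_eqI[of _ m l p] t_mult_closed[OF _ B])
      (auto simp: t_mult_index[OF t_smult_closed[OF A] B] t_mult_index[OF A B] t_smult_index[OF AB] t_smult_index[OF A] A nat_mod_less
        sum_distrib_left mult.assoc)
  show "A *\<^sub>t (c \<cdot>\<^sub>t B) = c \<cdot>\<^sub>t (A *\<^sub>t B)"
    using t_smult_closed[OF B] t_smult_closed[OF AB] p
    by (intro tensor_eqI[of _ m l p] t_mult_closed[OF A])
      (auto simp: t_mult_index[OF A t_smult_closed[OF B]] t_mult_index[OF A B] t_smult_index[OF AB] t_smult_index[OF B] B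
        sum_distrib_left mult.left_commute)
qed

section \<open>Existence of the T-Drazin inverse\<close>

definition tensor_monoid :: "nat \<Rightarrow> nat \<Rightarrow> 'a :: semiring_1 tensor monoid" where
  "tensor_monoid n p = \<lparr>carrier = carrier_tensor n n p, mult = (*\<^sub>t), one = t_one n p\<rparr>"

lemma tensor_monoid_simps:
  "carrier (tensor_monoid n p) = carrier_tensor n n p"
  "mult (tensor_monoid n p) = (*\<^sub>t)"
  "one (tensor_monoid n p) = t_one n p"
  by (simp_all add: tensor_monoid_def)

lemma monoid_tensor_monoid: "p > 0 \<Longrightarrow> monoid (tensor_monoid n p :: 'a :: semiring_1 tensor monoid)"
  by unfold_locales
    (auto simp: tensor_monoid_simps t_mult_one intro: t_mult_closed t_one_closed t_mult_assoc)

lemma tensor_monoid_pow: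
  assumes "A \<in> carrier_tensor n n p" "p > 0"
  shows "A [^]\<^bsub>tensor_monoid n p\<^esub> (k :: nat) = A ^\<^sub>t k"
  by (induction k) (simp_all add: tensor_monoid_simps carrier_tensor_dims[OF assms])

lemma t_pow_closed:
  assumes "A \<in> carrier_tensor n n p" "p > 0"
  shows "A ^\<^sub>t k \<in> carrier_tensor n n p"
  using monoid.nat_pow_closed[OF monoid_tensor_monoid[OF assms(2)], of A n k] assms
  by (simp add: tensor_monoid_simps tensor_monoid_pow)

lemma t_pow_Suc2:
  assumes "A \<in> carrier_tensor n n p" "p > 0"
  shows "A *\<^sub>t A ^\<^sub>t k = A ^\<^sub>t Suc k"
  using monoid.nat_pow_Suc2[OF monoid_tensor_monoid[OF assms(2)], of A n k] assms
  by (simp add: tensor_monoid_simps tensor_monoid_pow)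

lemma bcirc_pow:
  assumes A: "A \<in> carrier_tensor n n p" and p: "p > 0"
  shows "bcirc (A ^\<^sub>t k) = bcirc A ^\<^sub>m k"
proof (induction k)
  case 0
  thus ?case using bcirc_closed[OF A p] by (simp add: carrier_tensor_dims[OF A p] bcirc_one[OF p])
next
  case (Suc k)
  thus ?case using bcirc_mult[OF t_pow_closed[OF A p] A p] by simp
qed

lemma is_t_drazin_iff:
  assumes "A \<in> carrier_tensor n n p" "p > 0"
  shows "is_t_drazin A X \<longleftrightarrow> monoid.drazin_inverse (tensor_monoid n p) (t_index A) A X"
  unfolding is_t_drazin_def monoid.drazin_inverse_def[OF monoid_tensor_monoid[OF assms(2)]]
  by (simp add: tensor_monoid_simps tensor_monoid_pow[OF assms] carrier_tensor_dims[OF assms])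

text \<open>
  The hypotheses of \<open>drazin_inverse_exists\<close> come from the rank identity that defines the index. A matrix
  \<open>Y\<close> with \<open>bcirc A ^\<^sub>m k = bcirc A ^\<^sub>m Suc k * Y\<close> need not be block circulant, but only its first block
  column matters: a tensor is determined by its unfolding, so folding \<open>Y * t_unfold (t_one n p)\<close> yields a
  tensor \<open>X\<close> with \<open>A ^\<^sub>t k = A ^\<^sub>t Suc k *\<^sub>t X\<close>. Here \<open>k = t_index A\<close>.
\<close>

lemma t_drazin_exists:
  fixes A :: "'a :: field tensor"
  assumes A: "A \<in> carrier_tensor n n p" and p: "p > 0"
  shows "\<exists>X. is_t_drazin A X"
proof -
  let ?N = "n * p" and ?M = "bcirc A" and ?k = "t_index A"
  interpret T: monoid "tensor_monoid n p :: 'a tensor monoid" using monoid_tensor_monoid[OF p] .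
  interpret vec_space "TYPE('a)" ?N .
  have M: "?M \<in> carrier_mat ?N ?N" using bcirc_closed[OF A p] .
  note pc = pow_carrier_mat[OF M]
  have rk: "rank (?M ^\<^sub>m Suc ?k) = rank (?M ^\<^sub>m ?k)"
    using mat_index_rank[OF M] by (simp add: t_index_def)
  obtain Y where Y: "Y \<in> carrier_mat ?N ?N" "?M ^\<^sub>m ?k = ?M ^\<^sub>m Suc ?k * Y"
    using factor_through_same_rank[OF pc M] rk by auto
  define X :: "'a tensor" where "X = t_fold p (Y * t_unfold (t_one n p))"
  have I: "t_unfold (t_one n p :: 'a tensor) \<in> carrier_mat ?N n" using t_unfold_closed[OF t_one_closed p] .
  have X: "X \<in> carrier_tensor n n p" "t_unfold X = Y * t_unfold (t_one n p)"
    using t_fold_closed[OF mult_carrier_mat[OF Y(1) I] p] t_unfold_fold[OF mult_carrier_mat[OF Y(1) I] p]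
    by (simp_all add: X_def)
  have fac: "A ^\<^sub>t Suc ?k *\<^sub>t X = A ^\<^sub>t ?k"
  proof (rule t_unfold_inject[OF t_mult_closed[OF t_pow_closed[OF A p] X(1) p] t_pow_closed[OF A p] p])
    have "t_unfold (A ^\<^sub>t Suc ?k *\<^sub>t X) = ?M ^\<^sub>m Suc ?k * (Y * t_unfold (t_one n p))"
      using t_unfold_mult[OF t_pow_closed[OF A p] X(1) p, of "Suc ?k"] bcirc_pow[OF A p, of "Suc ?k"] X(2) by simp
    also have "\<dots> = ?M ^\<^sub>m Suc ?k * Y * t_unfold (t_one n p)"
      using assoc_mult_mat[OF pc Y(1) I, of "Suc ?k"] by simp
    also have "\<dots> = ?M ^\<^sub>m ?k * t_unfold (t_one n p)" using Y(2) by simp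
    also have "\<dots> = t_unfold (A ^\<^sub>t ?k *\<^sub>t t_one n p)"
      using t_unfold_mult[OF t_pow_closed[OF A p] t_one_closed p, of ?k] bcirc_pow[OF A p, of ?k] by simp
    also have "\<dots> = t_unfold (A ^\<^sub>t ?k)" using t_mult_one(1)[OF t_pow_closed[OF A p] p] by simp
    finally show "t_unfold (A ^\<^sub>t Suc ?k *\<^sub>t X) = t_unfold (A ^\<^sub>t ?k)" .
  qed
  have cancel: "A ^\<^sub>t ?k *\<^sub>t V = A ^\<^sub>t ?k *\<^sub>t W"
    if V: "V \<in> carrier_tensor n n p" and W: "W \<in> carrier_tensor n n p"
      and eq: "A ^\<^sub>t Suc ?k *\<^sub>t V = A ^\<^sub>t Suc ?k *\<^sub>t W" for V W
  proof (rule t_unfold_inject[OF t_mult_closed[OF t_pow_closed[OF A p] V p] t_mult_closed[OF t_pow_closed[OF A p] W p] p])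
    have "?M * ?M ^\<^sub>m ?k * t_unfold V = ?M * ?M ^\<^sub>m ?k * t_unfold W"
      using arg_cong[OF eq, of t_unfold] t_unfold_mult[OF t_pow_closed[OF A p] V p, of "Suc ?k"]
        t_unfold_mult[OF t_pow_closed[OF A p] W p, of "Suc ?k"] bcirc_pow[OF A p, of "Suc ?k"] pow_mat_Suc2[OF M, of ?k]
      by simp
    hence "?M ^\<^sub>m ?k * t_unfold V = ?M ^\<^sub>m ?k * t_unfold W"
      using cancel_mult_same_rank[OF M pc, of ?k "t_unfold V" n "t_unfold W"] rk pow_mat_Suc2[OF M, of ?k]
        t_unfold_closed[OF V p] t_unfold_closed[OF W p] by simp
    thus "t_unfold (A ^\<^sub>t ?k *\<^sub>t V) = t_unfold (A ^\<^sub>t ?k *\<^sub>t W)"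
      using t_unfold_mult[OF t_pow_closed[OF A p] V p, of ?k]
        t_unfold_mult[OF t_pow_closed[OF A p] W p, of ?k] bcirc_pow[OF A p, of ?k] by simp
  qed
  show ?thesis
    unfolding is_t_drazin_iff[OF A p]
    using T.drazin_inverse_exists[of A X ?k, unfolded tensor_monoid_pow[OF A p] tensor_monoid_simps, OF A X(1) fac cancel]
    by blast
qed

lemma is_t_drazin_t_drazin:
  fixes A :: "'a :: field tensor"
  assumes A: "A \<in> carrier_tensor n n p" and p: "p > 0"
  shows "is_t_drazin A (t_drazin A)"
proof -
  interpret T: monoid "tensor_monoid n p :: 'a tensor monoid" using monoid_tensor_monoid[OF p] .
  obtain X where "is_t_drazin A X" using t_drazin_exists[OF A p] ..
  moreover have "Y = X" if "is_t_drazin A Y" for Y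
    using T.drazin_inverse_unique[of A "t_index A" Y X] that calculation A
    unfolding is_t_drazin_iff[OF A p] tensor_monoid_simps by blast
  ultimately show ?thesis unfolding t_drazin_def by (rule theI)
qed

text \<open>
  A right factorization of \<open>A ^\<^sub>t k\<close> through \<open>A ^\<^sub>t Suc k\<close> makes the ranks of these two powers
  of \<open>bcirc A\<close> equal.
\<close>

lemma t_index_le:
  fixes A :: "'a :: field tensor"
  assumes A: "A \<in> carrier_tensor n n p" and p: "p > 0" and X: "X \<in> carrier_tensor n n p"
    and eq: "A ^\<^sub>t k = A ^\<^sub>t Suc k *\<^sub>t X"
  shows "t_index A \<le> k"
  unfolding t_index_def
proof (rule mat_index_le[OF bcirc_closed[OF A p] bcirc_closed[OF X p]])
  show "bcirc A ^\<^sub>m k = bcirc A ^\<^sub>m Suc k * bcirc X"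
    using arg_cong[OF eq, of bcirc] bcirc_mult[OF t_pow_closed[OF A p] X p, of "Suc k"]
      bcirc_pow[OF A p, of k] bcirc_pow[OF A p, of "Suc k"] by simp
qed

section \<open>Limits of tensors\<close>

lemma t_tendsto_iff:
  assumes "L \<in> carrier_tensor m n p" "p > 0"
  shows "t_tendsto f L F \<longleftrightarrow> (\<forall>\<^sub>F z in F. f z \<in> carrier_tensor m n p) \<and>
    (\<forall>a<p. \<forall>i<m. \<forall>j<n. ((\<lambda>z. f z ! a $$ (i, j)) \<longlongrightarrow> L ! a $$ (i, j)) F)"
  unfolding t_tendsto_def by (simp add: carrier_tensor_dims[OF assms])

lemma t_tendstoI:
  assumes "L \<in> carrier_tensor m n p" "p > 0"
    and "\<forall>\<^sub>F z in F. f z \<in> carrier_tensor m n p"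
    and "\<And>a i j. a < p \<Longrightarrow> i < m \<Longrightarrow> j < n \<Longrightarrow> ((\<lambda>z. f z ! a $$ (i, j)) \<longlongrightarrow> L ! a $$ (i, j)) F"
  shows "t_tendsto f L F"
  using assms by (simp add: t_tendsto_iff)

lemma t_tendstoD:
  assumes "t_tendsto f L F" "L \<in> carrier_tensor m n p" "p > 0"
  shows "\<forall>\<^sub>F z in F. f z \<in> carrier_tensor m n p"
    and "a < p \<Longrightarrow> i < m \<Longrightarrow> j < n \<Longrightarrow> ((\<lambda>z. f z ! a $$ (i, j)) \<longlongrightarrow> L ! a $$ (i, j)) F"
  using assms by (simp_all add: t_tendsto_iff)

lemma t_tendsto_const: "L \<in> carrier_tensor m n p \<Longrightarrow> p > 0 \<Longrightarrow> t_tendsto (\<lambda>z. L) L F"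
  by (simp add: t_tendsto_iff)

lemma t_tendsto_transform:
  assumes g: "t_tendsto g L F" and eq: "\<forall>\<^sub>F z in F. f z = g z"
  shows "t_tendsto f L F"
proof -
  have "\<forall>\<^sub>F z in F. f z \<in> K" if "\<forall>\<^sub>F z in F. g z \<in> K" for K
    using that eq by eventually_elim simp
  moreover have "((\<lambda>z. f z ! a $$ ij) \<longlongrightarrow> l) F" if "((\<lambda>z. g z ! a $$ ij) \<longlongrightarrow> l) F" for a ij l
    by (rule Lim_transform_eventually[OF that], use eq in eventually_elim) simp
  ultimately show ?thesis using g unfolding t_tendsto_def by blast
qed

lemma t_tendsto_unique:
  assumes "t_tendsto f L F" "t_tendsto f L' F" "L \<in> carrier_tensor m n p" "L' \<in> carrier_tensor m n p"
    and "p > 0" "F \<noteq> bot"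
  shows "L = L'"
proof (rule tensor_eqI[OF assms(3,4)])
  fix a i j assume "a < p" "i < m" "j < n"
  thus "L ! a $$ (i, j) = L' ! a $$ (i, j)"
    using tendsto_unique[OF assms(6) t_tendstoD(2)[OF assms(1,3,5)] t_tendstoD(2)[OF assms(2,4,5)]] by blast
qed

lemma t_tendsto_add:
  assumes f: "t_tendsto f L F" and g: "t_tendsto g K F"
    and L: "L \<in> carrier_tensor m n p" and K: "K \<in> carrier_tensor m n p" and p: "p > 0"
  shows "t_tendsto (\<lambda>z. f z +\<^sub>t g z) (L +\<^sub>t K) F"
proof (rule t_tendstoI[OF t_add_closed[OF L K] p])
  note ev = t_tendstoD(1)[OF f L p] t_tendstoD(1)[OF g K p]
  show "\<forall>\<^sub>F z in F. f z +\<^sub>t g z \<in> carrier_tensor m n p"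
    using ev by eventually_elim (rule t_add_closed)
  fix a i j assume ij: "a < p" "i < m" "j < n"
  have "\<forall>\<^sub>F z in F. f z ! a $$ (i, j) + g z ! a $$ (i, j) = (f z +\<^sub>t g z) ! a $$ (i, j)"
    using ev by eventually_elim (simp add: t_add_index[OF _ _ ij])
  from Lim_transform_eventually[OF tendsto_add[OF t_tendstoD(2)[OF f L p ij] t_tendstoD(2)[OF g K p ij]] this]
  show "((\<lambda>z. (f z +\<^sub>t g z) ! a $$ (i, j)) \<longlongrightarrow> (L +\<^sub>t K) ! a $$ (i, j)) F"
    by (simp add: t_add_index[OF L K ij])
qed

lemma t_tendsto_minus:
  assumes f: "t_tendsto f L F" and g: "t_tendsto g K F"
    and L: "L \<in> carrier_tensor m n p" and K: "K \<in> carrier_tensor m n p" and p: "p > 0"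
  shows "t_tendsto (\<lambda>z. f z -\<^sub>t g z) (L -\<^sub>t K) F"
proof (rule t_tendstoI[OF t_minus_closed[OF L K] p])
  note ev = t_tendstoD(1)[OF f L p] t_tendstoD(1)[OF g K p]
  show "\<forall>\<^sub>F z in F. f z -\<^sub>t g z \<in> carrier_tensor m n p"
    using ev by eventually_elim (rule t_minus_closed)
  fix a i j assume ij: "a < p" "i < m" "j < n"
  have "\<forall>\<^sub>F z in F. f z ! a $$ (i, j) - g z ! a $$ (i, j) = (f z -\<^sub>t g z) ! a $$ (i, j)"
    using ev by eventually_elim (simp add: t_minus_index[OF _ _ ij])
  from Lim_transform_eventually[OF tendsto_diff[OF t_tendstoD(2)[OF f L p ij] t_tendstoD(2)[OF g K p ij]] this]
  show "((\<lambda>z. (f z -\<^sub>t g z) ! a $$ (i, j)) \<longlongrightarrow> (L -\<^sub>t K) ! a $$ (i, j)) F"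
    by (simp add: t_minus_index[OF L K ij])
qed

lemma t_tendsto_smult:
  assumes c: "(c \<longlongrightarrow> c') F" and f: "t_tendsto f L F"
    and L: "L \<in> carrier_tensor m n p" and p: "p > 0"
  shows "t_tendsto (\<lambda>z. c z \<cdot>\<^sub>t f z) (c' \<cdot>\<^sub>t L) F"
proof (rule t_tendstoI[OF t_smult_closed[OF L] p])
  note ev = t_tendstoD(1)[OF f L p]
  show "\<forall>\<^sub>F z in F. c z \<cdot>\<^sub>t f z \<in> carrier_tensor m n p"
    using ev by eventually_elim (rule t_smult_closed)
  fix a i j assume ij: "a < p" "i < m" "j < n"
  have "\<forall>\<^sub>F z in F. c z * f z ! a $$ (i, j) = (c z \<cdot>\<^sub>t f z) ! a $$ (i, j)"
    using ev by eventually_elim (simp add: t_smult_index[OF _ ij])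
  from Lim_transform_eventually[OF tendsto_mult[OF c t_tendstoD(2)[OF f L p ij]] this]
  show "((\<lambda>z. (c z \<cdot>\<^sub>t f z) ! a $$ (i, j)) \<longlongrightarrow> (c' \<cdot>\<^sub>t L) ! a $$ (i, j)) F"
    by (simp add: t_smult_index[OF L ij])
qed

lemma t_tendsto_mult:
  assumes f: "t_tendsto f L F" and g: "t_tendsto g K F"
    and L: "L \<in> carrier_tensor m n p" and K: "K \<in> carrier_tensor n l p" and p: "p > 0"
  shows "t_tendsto (\<lambda>z. f z *\<^sub>t g z) (L *\<^sub>t K) F"
proof (rule t_tendstoI[OF t_mult_closed[OF L K p] p])
  note ev = t_tendstoD(1)[OF f L p] t_tendstoD(1)[OF g K p]
  show "\<forall>\<^sub>F z in F. f z *\<^sub>t g z \<in> carrier_tensor m l p"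
    using ev by eventually_elim (rule t_mult_closed[OF _ _ p])
  fix a i j assume ij: "a < p" "i < m" "j < l"
  let ?g = "\<lambda>c. nat ((int a - int c) mod int p)"
  have "\<forall>\<^sub>F z in F. (\<Sum>c<p. \<Sum>s<n. f z ! ?g c $$ (i, s) * g z ! c $$ (s, j)) = (f z *\<^sub>t g z) ! a $$ (i, j)"
    using ev by eventually_elim (simp add: t_mult_index[OF _ _ ij])
  moreover have "((\<lambda>z. \<Sum>c<p. \<Sum>s<n. f z ! ?g c $$ (i, s) * g z ! c $$ (s, j)) \<longlongrightarrow>
      (\<Sum>c<p. \<Sum>s<n. L ! ?g c $$ (i, s) * K ! c $$ (s, j))) F"
    using ij p by (intro tendsto_sum tendsto_mult t_tendstoD(2)[OF f L p] t_tendstoD(2)[OF g K p] nat_mod_less) auto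
  ultimately show "((\<lambda>z. (f z *\<^sub>t g z) ! a $$ (i, j)) \<longlongrightarrow> (L *\<^sub>t K) ! a $$ (i, j)) F"
    unfolding t_mult_index[OF L K ij] by (rule Lim_transform_eventually[rotated])
qed

lemma tendsto_det:
  fixes M :: "'b \<Rightarrow> 'a :: real_normed_field mat"
  assumes M: "\<forall>\<^sub>F z in F. M z \<in> carrier_mat N N" and M': "M' \<in> carrier_mat N N"
    and lim: "\<And>i j. i < N \<Longrightarrow> j < N \<Longrightarrow> ((\<lambda>z. M z $$ (i, j)) \<longlongrightarrow> M' $$ (i, j)) F"
  shows "((\<lambda>z. det (M z)) \<longlongrightarrow> det M') F"
proof -
  have "\<forall>\<^sub>F z in F. (\<Sum>\<pi> | \<pi> permutes {0..<N}. signof \<pi> * (\<Prod>i = 0..<N. M z $$ (i, \<pi> i))) = det (M z)"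
    using M by eventually_elim (simp add: det_def')
  moreover have "((\<lambda>z. \<Sum>\<pi> | \<pi> permutes {0..<N}. signof \<pi> * (\<Prod>i = 0..<N. M z $$ (i, \<pi> i))) \<longlongrightarrow> det M') F"
    unfolding det_def'[OF M']
    by (intro tendsto_sum tendsto_mult tendsto_const tendsto_prod lim) (auto dest: permutes_in_image)
  ultimately show ?thesis by (rule Lim_transform_eventually[rotated])
qed

lemma tendsto_adj_mat:
  fixes M :: "'b \<Rightarrow> 'a :: real_normed_field mat"
  assumes M: "\<forall>\<^sub>F z in F. M z \<in> carrier_mat N N" and M': "M' \<in> carrier_mat N N"
    and lim: "\<And>i j. i < N \<Longrightarrow> j < N \<Longrightarrow> ((\<lambda>z. M z $$ (i, j)) \<longlongrightarrow> M' $$ (i, j)) F"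
    and ij: "i < N" "j < N"
  shows "((\<lambda>z. adj_mat (M z) $$ (i, j)) \<longlongrightarrow> adj_mat M' $$ (i, j)) F"
proof -
  have "((\<lambda>z. det (mat_delete (M z) j i)) \<longlongrightarrow> det (mat_delete M' j i)) F"
  proof (rule tendsto_det)
    show "\<forall>\<^sub>F z in F. mat_delete (M z) j i \<in> carrier_mat (N - 1) (N - 1)"
      using M by eventually_elim (rule mat_delete_carrier)
    show "mat_delete M' j i \<in> carrier_mat (N - 1) (N - 1)" using mat_delete_carrier[OF M'] .
    fix r s assume rs: "r < N - 1" "s < N - 1"
    let ?r = "if r < j then r else Suc r" and ?s = "if s < i then s else Suc s"
    have "\<forall>\<^sub>F z in F. M z $$ (?r, ?s) = mat_delete (M z) j i $$ (r, s)"
      using M by eventually_elim (use rs in \<open>simp add: mat_delete_def\<close>)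
    moreover have "((\<lambda>z. M z $$ (?r, ?s)) \<longlongrightarrow> M' $$ (?r, ?s)) F" using rs by (intro lim) auto
    ultimately have "((\<lambda>z. mat_delete (M z) j i $$ (r, s)) \<longlongrightarrow> M' $$ (?r, ?s)) F"
      by (rule Lim_transform_eventually[rotated])
    thus "((\<lambda>z. mat_delete (M z) j i $$ (r, s)) \<longlongrightarrow> mat_delete M' j i $$ (r, s)) F"
      using M' rs by (simp add: mat_delete_def)
  qed
  hence "((\<lambda>z. cofactor (M z) j i) \<longlongrightarrow> cofactor M' j i) F"
    unfolding cofactor_def by (intro tendsto_mult tendsto_const)
  moreover have "\<forall>\<^sub>F z in F. cofactor (M z) j i = adj_mat (M z) $$ (i, j)"
    using M by eventually_elim (use ij in \<open>simp add: adj_mat_def\<close>)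
  ultimately have "((\<lambda>z. adj_mat (M z) $$ (i, j)) \<longlongrightarrow> cofactor M' j i) F"
    by (rule Lim_transform_eventually)
  thus ?thesis using M' ij by (simp add: adj_mat_def)
qed

section \<open>Inverses of tensors and their continuity\<close>

text \<open>
  The tensor whose unfolding is the first block column of the adjugate of \<open>bcirc B\<close>. Its product
  with \<open>B\<close> is \<open>det (bcirc B)\<close> times the identity, and its entries are polynomials in those of \<open>B\<close>, which
  makes the continuity of inversion visible.
\<close>

definition t_adj :: "nat \<Rightarrow> nat \<Rightarrow> 'a :: comm_ring_1 tensor \<Rightarrow> 'a tensor" where
  "t_adj n p B = t_fold p (adj_mat (bcirc B) * t_unfold (t_one n p))"

lemma t_adj_closed:
  assumes "B \<in> carrier_tensor n n p" "p > 0"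
  shows "t_adj n p B \<in> carrier_tensor n n p"
  unfolding t_adj_def
  using t_fold_closed[OF mult_carrier_mat[OF adj_mat(1)[OF bcirc_closed[OF assms]] t_unfold_closed[OF t_one_closed assms(2)]] assms(2)] .

lemma mult_t_adj:
  fixes B :: "'a :: comm_ring_1 tensor"
  assumes B: "B \<in> carrier_tensor n n p" and p: "p > 0"
  shows "B *\<^sub>t t_adj n p B = det (bcirc B) \<cdot>\<^sub>t t_one n p"
proof (rule t_unfold_inject[OF t_mult_closed[OF B t_adj_closed[OF B p] p] t_smult_closed[OF t_one_closed] p])
  let ?M = "bcirc B" and ?I = "t_unfold (t_one n p :: 'a tensor)"
  have M: "?M \<in> carrier_mat (n * p) (n * p)" using bcirc_closed[OF B p] .
  have I: "?I \<in> carrier_mat (n * p) n" using t_unfold_closed[OF t_one_closed p] .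
  have "t_unfold (B *\<^sub>t t_adj n p B) = ?M * (adj_mat ?M * ?I)"
    unfolding t_unfold_mult[OF B t_adj_closed[OF B p] p]
    using t_unfold_fold[OF mult_carrier_mat[OF adj_mat(1)[OF M] I] p] by (simp add: t_adj_def)
  also have "\<dots> = (?M * adj_mat ?M) * ?I"
    using assoc_mult_mat[OF M adj_mat(1)[OF M] I] by simp
  also have "\<dots> = det ?M \<cdot>\<^sub>m ?I"
    unfolding adj_mat(2)[OF M] using I mult_smult_assoc_mat[OF one_carrier_mat I, of "det ?M"] by simp
  also have "\<dots> = t_unfold (det ?M \<cdot>\<^sub>t t_one n p)"
  proof (rule eq_matI)
    fix r j assume "r < dim_row (t_unfold (det ?M \<cdot>\<^sub>t t_one n p :: 'a tensor))"
      "j < dim_col (t_unfold (det ?M \<cdot>\<^sub>t t_one n p :: 'a tensor))"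
    hence rj: "r < n * p" "j < n"
      using t_unfold_closed[OF t_smult_closed[OF t_one_closed] p, of "det ?M" n] by auto
    hence d: "r div n < p" "r mod n < n" by (auto simp: less_mult_imp_div_less mult.commute)
    show "(det ?M \<cdot>\<^sub>m ?I) $$ (r, j) = t_unfold (det ?M \<cdot>\<^sub>t t_one n p) $$ (r, j)"
      using I rj t_unfold_index[of "t_one n p :: 'a tensor", OF t_one_closed d rj(2)]
        t_unfold_index[OF t_smult_closed[OF t_one_closed] d rj(2), of "det ?M"]
        t_smult_index[OF t_one_closed d rj(2), of "det ?M"] by simp
  qed (use I t_unfold_closed[OF t_smult_closed[OF t_one_closed] p, of "det ?M" n] in auto)
  finally show "t_unfold (B *\<^sub>t t_adj n p B) = t_unfold (det ?M \<cdot>\<^sub>t t_one n p)" .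
qed

lemma t_smult_smult: "a \<cdot>\<^sub>t b \<cdot>\<^sub>t (A :: 'a :: semigroup_mult tensor) = (a * b) \<cdot>\<^sub>t A"
  by (auto simp: t_smult_def mult.assoc)

lemma t_smult_one: "1 \<cdot>\<^sub>t (A :: 'a :: monoid_mult tensor) = A"
  by (auto simp: t_smult_def intro!: map_idI)

lemma t_inv_eqI:
  fixes B :: "'a :: semiring_1 tensor"
  assumes B: "B \<in> carrier_tensor n n p" and X: "X \<in> carrier_tensor n n p" and p: "p > 0"
    and "B *\<^sub>t X = t_one n p" "X *\<^sub>t B = t_one n p"
  shows "t_inv B = X"
proof -
  have uniq: "Y = X"
    if Y: "Y \<in> carrier_tensor n n p \<and> B *\<^sub>t Y = t_one n p \<and> Y *\<^sub>t B = t_one n p" for Y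
  proof -
    have "Y = X *\<^sub>t B *\<^sub>t Y" using t_mult_one(2)[of Y n n p] Y p assms(5) by simp
    also have "\<dots> = X" using t_mult_assoc[OF X B _ p, of Y n] Y t_mult_one(1)[OF X p] by simp
    finally show ?thesis .
  qed
  show ?thesis unfolding t_inv_def Let_def carrier_tensor_dims[OF B p]
    by (rule the_equality[OF _ uniq]) (use assms in auto)
qed

lemma t_inv_adj:
  fixes B :: "'a :: field tensor"
  assumes B: "B \<in> carrier_tensor n n p" and p: "p > 0" and det: "det (bcirc B) \<noteq> 0"
  shows "t_inv B = (1 / det (bcirc B)) \<cdot>\<^sub>t t_adj n p B"
    and "t_inv B \<in> carrier_tensor n n p"
    and "B *\<^sub>t t_inv B = t_one n p" "t_inv B *\<^sub>t B = t_one n p"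
proof -
  define X where "X = (1 / det (bcirc B)) \<cdot>\<^sub>t t_adj n p B"
  have X: "X \<in> carrier_tensor n n p" unfolding X_def using t_smult_closed[OF t_adj_closed[OF B p]] .
  have BX: "B *\<^sub>t X = t_one n p"
    unfolding X_def t_smult_mult(2)[OF p B t_adj_closed[OF B p]] mult_t_adj[OF B p] t_smult_smult
    using det by (simp add: t_smult_one)
  \<comment> \<open>A right inverse of a square matrix is a left inverse; injectivity of bcirc transports this back to
    tensors.\<close>
  have "bcirc B * bcirc X = 1\<^sub>m (n * p)"
    using bcirc_mult[OF B X p] BX bcirc_one[OF p] by metis
  hence "bcirc X * bcirc B = 1\<^sub>m (n * p)"
    by (rule mat_mult_left_right_inverse[OF bcirc_closed[OF B p] bcirc_closed[OF X p]])
  hence XB: "X *\<^sub>t B = t_one n p"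
    by (intro bcirc_inject[OF t_mult_closed[OF X B p] t_one_closed p])
      (simp add: bcirc_mult[OF X B p] bcirc_one[OF p])
  have "t_inv B = X" using t_inv_eqI[OF B X p BX XB] .
  thus "t_inv B = (1 / det (bcirc B)) \<cdot>\<^sub>t t_adj n p B" "t_inv B \<in> carrier_tensor n n p"
    "B *\<^sub>t t_inv B = t_one n p" "t_inv B *\<^sub>t B = t_one n p"
    using X BX XB by (simp_all add: X_def)
qed

lemma tendsto_bcirc:
  assumes f: "t_tendsto f B F" and B: "B \<in> carrier_tensor m n p" and p: "p > 0"
    and rc: "r < m * p" "c < n * p"
  shows "((\<lambda>z. bcirc (f z) $$ (r, c)) \<longlongrightarrow> bcirc B $$ (r, c)) F"
proof -
  have mn: "m > 0" "n > 0" using rc by (auto intro: gr0I)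
  define a b i j where ab: "a = r div m" "b = c div n" "i = r mod m" "j = c mod n"
  have less: "a < p" "b < p" "i < m" "j < n"
    using rc mn by (auto simp: ab less_mult_imp_div_less mult.commute)
  have rc': "r = a * m + i" "c = b * n + j" by (simp_all add: ab)
  have "\<forall>\<^sub>F z in F. f z ! nat ((int a - int b) mod int p) $$ (i, j) = bcirc (f z) $$ (r, c)"
    using t_tendstoD(1)[OF f B p] unfolding rc' by eventually_elim (simp add: bcirc_block less)
  moreover have "((\<lambda>z. f z ! nat ((int a - int b) mod int p) $$ (i, j)) \<longlongrightarrow> bcirc B $$ (r, c)) F"
    unfolding rc' bcirc_block[OF B less] using t_tendstoD(2)[OF f B p nat_mod_less[OF p] less(3,4)] .
  ultimately show ?thesis by (rule Lim_transform_eventually[rotated])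
qed

lemma t_tendsto_t_adj:
  assumes f: "t_tendsto f B F" and B: "B \<in> carrier_tensor n n p" and p: "p > 0"
  shows "t_tendsto (\<lambda>z. t_adj n p (f z)) (t_adj n p B) F"
proof (rule t_tendstoI[OF t_adj_closed[OF B p] p])
  note ev = t_tendstoD(1)[OF f B p]
  show "\<forall>\<^sub>F z in F. t_adj n p (f z) \<in> carrier_tensor n n p"
    using ev by eventually_elim (rule t_adj_closed[OF _ p])
  fix a i j assume aij: "a < p" "i < n" "j < n"
  let ?r = "a * n + i" and ?I = "t_unfold (t_one n p :: complex tensor)"
  have I: "?I \<in> carrier_mat (n * p) n" using t_unfold_closed[OF t_one_closed p] .
  have r: "?r < n * p" using block_index_less aij by blast
  have entry: "t_adj n p C ! a $$ (i, j) = (\<Sum>s<n * p. adj_mat (bcirc C) $$ (?r, s) * ?I $$ (s, j))"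
    if C: "C \<in> carrier_tensor n n p" for C
  proof -
    have adj: "adj_mat (bcirc C) \<in> carrier_mat (n * p) (n * p)" using adj_mat(1)[OF bcirc_closed[OF C p]] .
    show ?thesis unfolding t_adj_def t_fold_index[OF mult_carrier_mat[OF adj I] aij]
      using adj I r aij by (simp add: scalar_prod_def lessThan_atLeast0)
  qed
  have "\<forall>\<^sub>F z in F. (\<Sum>s<n * p. adj_mat (bcirc (f z)) $$ (?r, s) * ?I $$ (s, j)) = t_adj n p (f z) ! a $$ (i, j)"
    using ev by eventually_elim (simp add: entry)
  moreover have "((\<lambda>z. \<Sum>s<n * p. adj_mat (bcirc (f z)) $$ (?r, s) * ?I $$ (s, j)) \<longlongrightarrow> t_adj n p B ! a $$ (i, j)) F"
    unfolding entry[OF B]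
  proof (intro tendsto_sum tendsto_mult tendsto_const tendsto_adj_mat[where N = "n * p"])
    show "\<forall>\<^sub>F z in F. bcirc (f z) \<in> carrier_mat (n * p) (n * p)"
      using ev by eventually_elim (rule bcirc_closed[OF _ p])
  qed (use r bcirc_closed[OF B p] tendsto_bcirc[OF f B p] in auto)
  ultimately show "((\<lambda>z. t_adj n p (f z) ! a $$ (i, j)) \<longlongrightarrow> t_adj n p B ! a $$ (i, j)) F"
    by (rule Lim_transform_eventually[rotated])
qed

lemma t_tendsto_inv:
  assumes f: "t_tendsto f B F" and B: "B \<in> carrier_tensor n n p" and p: "p > 0"
    and det: "det (bcirc B) \<noteq> 0"
  shows "\<forall>\<^sub>F z in F. det (bcirc (f z)) \<noteq> 0" "t_tendsto (\<lambda>z. t_inv (f z)) (t_inv B) F"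
proof -
  note ev = t_tendstoD(1)[OF f B p]
  have "\<forall>\<^sub>F z in F. bcirc (f z) \<in> carrier_mat (n * p) (n * p)"
    using ev by eventually_elim (rule bcirc_closed[OF _ p])
  hence lim: "((\<lambda>z. det (bcirc (f z))) \<longlongrightarrow> det (bcirc B)) F"
    using tendsto_det[OF _ bcirc_closed[OF B p] tendsto_bcirc[OF f B p]] by blast
  show det': "\<forall>\<^sub>F z in F. det (bcirc (f z)) \<noteq> 0"
    using tendsto_imp_eventually_ne[OF lim det] .
  have eq: "\<forall>\<^sub>F z in F. t_inv (f z) = (1 / det (bcirc (f z))) \<cdot>\<^sub>t t_adj n p (f z)"
    using ev det' by eventually_elim (rule t_inv_adj(1)[OF _ p])
  show "t_tendsto (\<lambda>z. t_inv (f z)) (t_inv B) F"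
    unfolding t_inv_adj(1)[OF B p det]
    by (intro t_tendsto_transform[OF _ eq] t_tendsto_smult[OF _ _ t_adj_closed[OF B p] p]
        tendsto_divide tendsto_const lim det t_tendsto_t_adj[OF f B p])
qed

lemma det_bcirc_one: "p > 0 \<Longrightarrow> det (bcirc (t_one n p :: 'a :: comm_ring_1 tensor)) = 1"
  by (simp add: bcirc_one)

lemma t_inv_one:
  "p > 0 \<Longrightarrow> t_inv (t_one n p :: 'a :: semiring_1 tensor) = t_one n p"
  by (intro t_inv_eqI[OF t_one_closed t_one_closed]) (simp_all add: t_mult_one[OF t_one_closed])

text \<open>
  The matrix \<open>bcirc (A +\<^sub>t z \<cdot>\<^sub>t t_one n p)\<close> is \<open>bcirc A\<close> shifted by \<open>z\<close>, and hence singular only if \<open>- z\<close> is one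
  of the finitely many eigenvalues of \<open>bcirc A\<close>.
\<close>

lemma eventually_det_shift:
  fixes A :: "complex tensor"
  assumes A: "A \<in> carrier_tensor n n p" and p: "p > 0"
  shows "\<forall>\<^sub>F z in at 0. det (bcirc (A +\<^sub>t z \<cdot>\<^sub>t t_one n p)) \<noteq> 0"
proof -
  let ?M = "bcirc A"
  have M: "?M \<in> carrier_mat (n * p) (n * p)" using bcirc_closed[OF A p] .
  have shift: "bcirc (A +\<^sub>t z \<cdot>\<^sub>t t_one n p) = char_matrix ?M (- z)" for z
  proof (rule block_mat_eqI)
    note z1 = t_smult_closed[OF t_one_closed, of z n p]
    show "bcirc (A +\<^sub>t z \<cdot>\<^sub>t t_one n p) \<in> carrier_mat (n * p) (n * p)"
      using bcirc_closed[OF t_add_closed[OF A z1] p] .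
    show "char_matrix ?M (- z) \<in> carrier_mat (n * p) (n * p)" using char_matrix_closed[OF M] .
    fix a b i j assume ab: "a < p" "b < p" and ij: "i < n" "j < n"
    note g = nat_mod_less[OF p, of "int a - int b"]
    have "(t_one n p :: complex tensor) ! nat ((int a - int b) mod int p) $$ (i, j) = 1\<^sub>m (n * p) $$ (a * n + i, b * n + j)"
      using bcirc_block[of "t_one n p :: complex tensor", OF t_one_closed ab ij] bcirc_one[OF p, where 'a = complex, of n] by simp
    thus "bcirc (A +\<^sub>t z \<cdot>\<^sub>t t_one n p) $$ (a * n + i, b * n + j) = char_matrix ?M (- z) $$ (a * n + i, b * n + j)"
      unfolding bcirc_block[OF t_add_closed[OF A z1] ab ij] t_add_index[OF A z1 g ij] t_smult_index[OF t_one_closed g ij]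
      using M block_index_less[OF ij(1) ab(1)] block_index_less[OF ij(2) ab(2)]
      by (simp add: char_matrix_def bcirc_block[OF A ab ij])
  qed
  have "finite {e. poly (char_poly ?M) e = 0}"
    using degree_monic_char_poly[OF M] by (intro poly_roots_finite) auto
  hence "finite (uminus ` {e. poly (char_poly ?M) e = 0})" by simp
  moreover have "{z. det (bcirc (A +\<^sub>t z \<cdot>\<^sub>t t_one n p)) = 0} \<subseteq> uminus ` {e. poly (char_poly ?M) e = 0}"
  proof
    fix z assume "z \<in> {z. det (bcirc (A +\<^sub>t z \<cdot>\<^sub>t t_one n p)) = 0}"
    hence "poly (char_poly ?M) (- z) = 0"
      unfolding shift eigenvalue_det[OF M, symmetric] eigenvalue_root_char_poly[OF M] by simp
    thus "z \<in> uminus ` {e. poly (char_poly ?M) e = 0}" by (intro image_eqI[of _ _ "- z"]) simp_all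
  qed
  ultimately have "finite {z. det (bcirc (A +\<^sub>t z \<cdot>\<^sub>t t_one n p)) = 0}"
    by (rule rev_finite_subset)
  hence "closed ({z. det (bcirc (A +\<^sub>t z \<cdot>\<^sub>t t_one n p)) = 0} - {0})" by (intro finite_imp_closed) simp
  hence "open (- ({z. det (bcirc (A +\<^sub>t z \<cdot>\<^sub>t t_one n p)) = 0} - {0}))" by (rule open_Compl)
  thus ?thesis unfolding eventually_at_topological by fastforce
qed

section \<open>The resolvent near zero\<close>

lemma t_smult_zero:
  fixes X Y :: "'a :: mult_zero tensor"
  assumes "X \<in> carrier_tensor m n p" "Y \<in> carrier_tensor m n p"
  shows "0 \<cdot>\<^sub>t X = 0 \<cdot>\<^sub>t Y"
  using assms by (intro tensor_eqI[of _ m n p] t_smult_closed) (simp_all add: t_smult_index)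

text \<open>
  With \<open>D = t_drazin A\<close>, the idempotent \<open>A *\<^sub>t D\<close> projects onto the part on which \<open>A\<close> is invertible, with
  inverse \<open>D\<close>; the complementary idempotent \<open>E\<close> projects onto the part on which \<open>A\<close> is nilpotent. \<open>R z\<close> is
  the resolvent at \<open>- z\<close>.
\<close>

locale t_drazin_splitting =
  fixes A :: "complex tensor" and n p :: nat
  assumes p: "p > 0" and A: "A \<in> carrier_tensor n n p"
begin

abbreviation "C \<equiv> carrier_tensor n n p"
abbreviation "I \<equiv> t_one n p :: complex tensor"
definition "D = t_drazin A"
definition "E = I -\<^sub>t A *\<^sub>t D"
definition "R z = t_inv (A +\<^sub>t z \<cdot>\<^sub>t I)"

text \<open>
  The rules for the fixed square shape \<open>C\<close>. The general rules mention inner dimensions that do not occur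
  in the shape of the result, so automation could not guess them.
\<close>

lemma mult_closed [simp]: "X \<in> C \<Longrightarrow> Y \<in> C \<Longrightarrow> X *\<^sub>t Y \<in> C"
  using t_mult_closed p by blast
lemma add_closed [simp]: "X \<in> C \<Longrightarrow> Y \<in> C \<Longrightarrow> X +\<^sub>t Y \<in> C"
  by (rule t_add_closed)
lemma minus_closed [simp]: "X \<in> C \<Longrightarrow> Y \<in> C \<Longrightarrow> X -\<^sub>t Y \<in> C"
  by (rule t_minus_closed)
lemma smult_closed [simp]: "X \<in> C \<Longrightarrow> c \<cdot>\<^sub>t X \<in> C"
  by (rule t_smult_closed)
lemma one_closed [simp]: "I \<in> C"
  by (rule t_one_closed)
lemma pow_closed [simp]: "A ^\<^sub>t j \<in> C"
  using t_pow_closed[OF A p] .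

lemma mult_assoc: "X \<in> C \<Longrightarrow> Y \<in> C \<Longrightarrow> Z \<in> C \<Longrightarrow> X *\<^sub>t Y *\<^sub>t Z = X *\<^sub>t (Y *\<^sub>t Z)"
  using t_mult_assoc p by blast

lemmas [simp] = A
  and mult_one [simp] = t_mult_one[OF _ p, of _ n n]
  and smult_mult [simp] = t_smult_mult[OF p, of _ n n _ n]
  and distrib_left = t_mult_add_distrib[OF p, of _ n n _ n]
  and distrib_right = t_add_mult_distrib[OF p, of _ n n _ _ n]

lemma lim_const: "X \<in> C \<Longrightarrow> t_tendsto (\<lambda>z. X) X F"
  using t_tendsto_const p by blast
lemma lim_add: "t_tendsto f X F \<Longrightarrow> t_tendsto g Y F \<Longrightarrow> X \<in> C \<Longrightarrow> Y \<in> C \<Longrightarrow>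
    t_tendsto (\<lambda>z. f z +\<^sub>t g z) (X +\<^sub>t Y) F"
  using t_tendsto_add p by blast
lemma lim_minus: "t_tendsto f X F \<Longrightarrow> t_tendsto g Y F \<Longrightarrow> X \<in> C \<Longrightarrow> Y \<in> C \<Longrightarrow>
    t_tendsto (\<lambda>z. f z -\<^sub>t g z) (X -\<^sub>t Y) F"
  using t_tendsto_minus p by blast
lemma lim_mult: "t_tendsto f X F \<Longrightarrow> t_tendsto g Y F \<Longrightarrow> X \<in> C \<Longrightarrow> Y \<in> C \<Longrightarrow>
    t_tendsto (\<lambda>z. f z *\<^sub>t g z) (X *\<^sub>t Y) F"
  using t_tendsto_mult p by blast
lemma lim_smult: "(c \<longlongrightarrow> c') F \<Longrightarrow> t_tendsto f X F \<Longrightarrow> X \<in> C \<Longrightarrow>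
    t_tendsto (\<lambda>z. c z \<cdot>\<^sub>t f z) (c' \<cdot>\<^sub>t X) F"
  using t_tendsto_smult p by blast

lemma pow_add: "A ^\<^sub>t i *\<^sub>t A ^\<^sub>t j = A ^\<^sub>t (i + j)"
  using monoid.nat_pow_mult[OF monoid_tensor_monoid[OF p], of A n i j] A
  by (simp add: tensor_monoid_simps tensor_monoid_pow[OF A p])

lemma D_closed [simp]: "D \<in> C"
  and D_pow: "A ^\<^sub>t t_index A *\<^sub>t D *\<^sub>t A = A ^\<^sub>t t_index A"
  and D_A_D: "D *\<^sub>t A *\<^sub>t D = D"
  and D_commute: "A *\<^sub>t D = D *\<^sub>t A"
  using is_t_drazin_t_drazin[OF A p] unfolding is_t_drazin_def D_def carrier_tensor_dims[OF A p] by auto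

lemma D_commute': "X \<in> C \<Longrightarrow> A *\<^sub>t (D *\<^sub>t X) = D *\<^sub>t (A *\<^sub>t X)"
  using D_commute by (simp flip: mult_assoc)

lemma E_closed [simp]: "E \<in> C"
  by (simp add: E_def)

lemma A_E: "A *\<^sub>t E = E *\<^sub>t A"
  unfolding E_def by (simp add: distrib_left distrib_right mult_assoc D_commute D_commute')

lemma pow_D_A: "A ^\<^sub>t j *\<^sub>t (A *\<^sub>t D) = A *\<^sub>t D *\<^sub>t A ^\<^sub>t j"
proof (induction j)
  case 0
  thus ?case by (simp add: carrier_tensor_dims[OF A p])
next
  case (Suc j)
  have "A ^\<^sub>t Suc j *\<^sub>t (A *\<^sub>t D) = A ^\<^sub>t j *\<^sub>t (A *\<^sub>t D) *\<^sub>t A"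
    by (simp add: mult_assoc D_commute D_commute')
  thus ?case by (simp add: Suc mult_assoc)
qed

lemma core_nilpotent_split: "X \<in> C \<Longrightarrow> X = E *\<^sub>t X +\<^sub>t A *\<^sub>t D *\<^sub>t X"
  unfolding E_def
  by (simp add: distrib_right) (rule tensor_eqI[of _ n n p], simp_all add: t_add_index[of _ n n p] t_minus_index[of _ n n p])

lemma E_pow:
  assumes "j \<ge> t_index A"
  shows "E *\<^sub>t A ^\<^sub>t j = 0 \<cdot>\<^sub>t I"
proof -
  let ?k = "t_index A"
  have "A *\<^sub>t D *\<^sub>t A ^\<^sub>t ?k = A ^\<^sub>t ?k *\<^sub>t (D *\<^sub>t A)"
    using pow_D_A[of ?k] D_commute by simp
  also have "\<dots> = A ^\<^sub>t ?k" using D_pow by (simp add: mult_assoc)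
  finally have "A *\<^sub>t D *\<^sub>t A ^\<^sub>t ?k = A ^\<^sub>t ?k" .
  hence "E *\<^sub>t A ^\<^sub>t ?k = A ^\<^sub>t ?k -\<^sub>t A ^\<^sub>t ?k" unfolding E_def by (simp add: distrib_right)
  also have "\<dots> = 0 \<cdot>\<^sub>t I"
    by (rule tensor_eqI[of _ n n p]) (simp_all add: t_minus_index[of _ n n p] t_smult_index[of _ n n p])
  finally have "E *\<^sub>t A ^\<^sub>t ?k *\<^sub>t A ^\<^sub>t (j - ?k) = 0 \<cdot>\<^sub>t A ^\<^sub>t (j - ?k)" by simp
  thus ?thesis using assms t_smult_zero[of "A ^\<^sub>t (j - ?k)" n n p I]
    by (simp add: mult_assoc pow_add)
qed

lemma resolvent_left_inverse:
  "\<forall>\<^sub>F z in at 0. R z \<in> C \<and> R z *\<^sub>t (A +\<^sub>t z \<cdot>\<^sub>t I) = I"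
  using eventually_det_shift[OF A p]
  unfolding R_def by eventually_elim (use t_inv_adj[OF add_closed[OF A smult_closed[OF one_closed]] p] in blast)

lemma resolvent_step:
  assumes "R z \<in> C" "R z *\<^sub>t (A +\<^sub>t z \<cdot>\<^sub>t I) = I" "X \<in> C"
  shows "z \<cdot>\<^sub>t (R z *\<^sub>t X) = X -\<^sub>t R z *\<^sub>t (A *\<^sub>t X)"
proof -
  have "X = R z *\<^sub>t (A +\<^sub>t z \<cdot>\<^sub>t I) *\<^sub>t X" using assms by simp
  also have "\<dots> = R z *\<^sub>t (A *\<^sub>t X) +\<^sub>t z \<cdot>\<^sub>t (R z *\<^sub>t X)"
    using assms(1,3) by (simp add: mult_assoc distrib_left distrib_right)
  finally have X: "X = R z *\<^sub>t (A *\<^sub>t X) +\<^sub>t z \<cdot>\<^sub>t (R z *\<^sub>t X)" .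
  show ?thesis
  proof (rule tensor_eqI[of _ n n p])
    fix a i j assume "a < p" "i < n" "j < n"
    thus "(z \<cdot>\<^sub>t (R z *\<^sub>t X)) ! a $$ (i, j) = (X -\<^sub>t R z *\<^sub>t (A *\<^sub>t X)) ! a $$ (i, j)"
      using arg_cong[OF X, of "\<lambda>T. T ! a $$ (i, j)"] assms(1,3)
      by (simp add: t_add_index[of _ n n p] t_minus_index[of _ n n p])
  qed (use assms in auto)
qed

text \<open>
  The resolvent may have a pole on the nilpotent part, and each factor \<open>A\<close> lowers its order by one: for
  \<open>m = 0\<close> the tensor \<open>E *\<^sub>t A ^\<^sub>t r\<close> vanishes, and \<open>resolvent_step\<close> trades a factor \<open>z\<close> for a factor
  \<open>A\<close>, whence an induction on \<open>m\<close>. The coefficient \<open>0\<close> in the case \<open>m = 0\<close> absorbs the possibly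
  truncated exponent \<open>m + r - 1\<close>.
\<close>

lemma nilpotent_part:
  assumes "m + r \<ge> t_index A"
  shows "t_tendsto (\<lambda>z. z ^ m \<cdot>\<^sub>t (R z *\<^sub>t (E *\<^sub>t A ^\<^sub>t r)))
    ((if m = 0 then 0 else (- 1) ^ (m + 1)) \<cdot>\<^sub>t (E *\<^sub>t A ^\<^sub>t (m + r - 1))) (at 0)"
  using assms
proof (induction m arbitrary: r)
  case 0
  have "\<forall>\<^sub>F z in at 0. z ^ 0 \<cdot>\<^sub>t (R z *\<^sub>t (E *\<^sub>t A ^\<^sub>t r)) = 0 \<cdot>\<^sub>t (E *\<^sub>t A ^\<^sub>t (r - 1))"
    using resolvent_left_inverse
  proof eventually_elim
    case (elim z)
    thus ?case using 0 t_smult_zero[of "R z" n n p "E *\<^sub>t A ^\<^sub>t (r - 1)"] by (simp add: E_pow t_smult_one)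
  qed
  from t_tendsto_transform[OF lim_const this] show ?case by simp
next
  case (Suc m)
  let ?X = "E *\<^sub>t A ^\<^sub>t r" and ?Y = "E *\<^sub>t A ^\<^sub>t Suc r"
  let ?c = "\<lambda>m. if m = 0 then 0 else (- 1) ^ (m + 1) :: complex"
  have AX: "A *\<^sub>t ?X = ?Y"
    using mult_assoc[of A E "A ^\<^sub>t r"] mult_assoc[of E A "A ^\<^sub>t r"] t_pow_Suc2[OF A p, of r] by (simp add: A_E del: t_pow.simps)
  have eq: "\<forall>\<^sub>F z in at 0. z ^ Suc m \<cdot>\<^sub>t (R z *\<^sub>t ?X) = z ^ m \<cdot>\<^sub>t ?X -\<^sub>t z ^ m \<cdot>\<^sub>t (R z *\<^sub>t ?Y)"
    using resolvent_left_inverse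
  proof eventually_elim
    case (elim z)
    hence "z ^ Suc m \<cdot>\<^sub>t (R z *\<^sub>t ?X) = z ^ m \<cdot>\<^sub>t (?X -\<^sub>t R z *\<^sub>t ?Y)"
      using resolvent_step[of z ?X] AX
      by (simp add: t_smult_smult[symmetric] power_Suc2 del: power_Suc t_pow.simps)
    thus ?case using elim
      by (intro tensor_eqI[of _ n n p])
        (simp_all add: t_minus_index[of _ n n p] t_smult_index[of _ n n p] right_diff_distrib del: t_pow.simps)
  qed
  have "t_tendsto (\<lambda>z. z ^ m \<cdot>\<^sub>t ?X -\<^sub>t z ^ m \<cdot>\<^sub>t (R z *\<^sub>t ?Y))
      (0 ^ m \<cdot>\<^sub>t ?X -\<^sub>t ?c m \<cdot>\<^sub>t (E *\<^sub>t A ^\<^sub>t (m + Suc r - 1))) (at 0)"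
    using Suc.prems
    by (intro lim_minus Suc.IH lim_smult lim_const tendsto_intros) auto
  moreover have "0 ^ m \<cdot>\<^sub>t ?X -\<^sub>t ?c m \<cdot>\<^sub>t (E *\<^sub>t A ^\<^sub>t (m + Suc r - 1)) = ?c (Suc m) \<cdot>\<^sub>t (E *\<^sub>t A ^\<^sub>t (Suc m + r - 1))"
    by (rule tensor_eqI[of _ n n p]) (simp_all add: t_minus_index[of _ n n p] t_smult_index[of _ n n p] del: t_pow.simps)
  ultimately show ?case using t_tendsto_transform[OF _ eq] by simp
qed

text \<open>
  Since \<open>(A +\<^sub>t z \<cdot>\<^sub>t I) *\<^sub>t D = A *\<^sub>t D *\<^sub>t (I +\<^sub>t z \<cdot>\<^sub>t D)\<close>, the resolvent on the invertible part is \<open>D\<close> times the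
  inverse of a perturbation of the identity, so it has no singularity at \<open>0\<close>.
\<close>

lemma core_part: "t_tendsto (\<lambda>z. R z *\<^sub>t (A *\<^sub>t D)) D (at 0)"
proof -
  let ?B = "\<lambda>z. I +\<^sub>t z \<cdot>\<^sub>t D"
  have "I +\<^sub>t 0 \<cdot>\<^sub>t D = I"
    by (rule tensor_eqI[of _ n n p]) (simp_all add: t_add_index[of _ n n p] t_smult_index[of _ n n p])
  moreover have "t_tendsto ?B (I +\<^sub>t 0 \<cdot>\<^sub>t D) (at 0)"
    by (intro lim_add lim_smult lim_const tendsto_intros) simp_all
  ultimately have B: "t_tendsto ?B I (at 0)" by simp
  have U: "\<forall>\<^sub>F z in at 0. det (bcirc (?B z)) \<noteq> 0" "t_tendsto (\<lambda>z. t_inv (?B z)) I (at 0)"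
    using t_tendsto_inv[OF B one_closed p] by (simp_all add: det_bcirc_one[OF p] t_inv_one[OF p])
  have eq: "\<forall>\<^sub>F z in at 0. R z *\<^sub>t (A *\<^sub>t D) = D *\<^sub>t t_inv (?B z)"
    using resolvent_left_inverse U(1)
  proof eventually_elim
    case (elim z)
    let ?U = "t_inv (?B z)"
    have U: "?U \<in> C" "?B z *\<^sub>t ?U = I" using t_inv_adj(2,3)[OF add_closed[OF one_closed smult_closed[OF D_closed]] p elim(2)] by simp_all
    have "A *\<^sub>t D *\<^sub>t ?B z = (A +\<^sub>t z \<cdot>\<^sub>t I) *\<^sub>t D"
      using D_A_D by (simp add: distrib_left distrib_right D_commute)
    hence "A *\<^sub>t D = (A +\<^sub>t z \<cdot>\<^sub>t I) *\<^sub>t (D *\<^sub>t ?U)"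
      using U mult_assoc[of "A *\<^sub>t D" "?B z" ?U] mult_assoc[of "A +\<^sub>t z \<cdot>\<^sub>t I" D ?U] by simp
    hence "R z *\<^sub>t (A *\<^sub>t D) = R z *\<^sub>t (A +\<^sub>t z \<cdot>\<^sub>t I) *\<^sub>t (D *\<^sub>t ?U)"
      using elim(1) U(1) mult_assoc[of "R z" "A +\<^sub>t z \<cdot>\<^sub>t I" "D *\<^sub>t ?U"] by simp
    thus ?case using elim(1) U(1) by simp
  qed
  have "t_tendsto (\<lambda>z. D *\<^sub>t t_inv (?B z)) (D *\<^sub>t I) (at 0)"
    using U(2) by (intro lim_mult lim_const) simp_all
  thus ?thesis using t_tendsto_transform[OF _ eq] by simp
qed

lemma limit_formula:
  assumes "m + q \<ge> t_index A"
  shows "t_tendsto (\<lambda>z. z ^ m \<cdot>\<^sub>t R z *\<^sub>t A ^\<^sub>t q)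
    (if m > 0 then (- 1) ^ (m + 1) \<cdot>\<^sub>t E *\<^sub>t A ^\<^sub>t (m + q - 1) else D *\<^sub>t A ^\<^sub>t q) (at 0)"
proof -
  let ?c = "if m = 0 then 0 else (- 1) ^ (m + 1) :: complex"
  let ?L = "?c \<cdot>\<^sub>t (E *\<^sub>t A ^\<^sub>t (m + q - 1))"
  have eq: "\<forall>\<^sub>F z in at 0. z ^ m \<cdot>\<^sub>t R z *\<^sub>t A ^\<^sub>t q =
      z ^ m \<cdot>\<^sub>t (R z *\<^sub>t (E *\<^sub>t A ^\<^sub>t q)) +\<^sub>t z ^ m \<cdot>\<^sub>t (R z *\<^sub>t (A *\<^sub>t D)) *\<^sub>t A ^\<^sub>t q"
    using resolvent_left_inverse
  proof eventually_elim
    case (elim z)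
    have "z ^ m \<cdot>\<^sub>t R z *\<^sub>t A ^\<^sub>t q = z ^ m \<cdot>\<^sub>t R z *\<^sub>t (E *\<^sub>t A ^\<^sub>t q +\<^sub>t A *\<^sub>t D *\<^sub>t A ^\<^sub>t q)"
      by (rule arg_cong[OF core_nilpotent_split]) simp
    thus ?case using elim by (simp add: distrib_left mult_assoc)
  qed
  have "t_tendsto (\<lambda>z. z ^ m \<cdot>\<^sub>t (R z *\<^sub>t (E *\<^sub>t A ^\<^sub>t q)) +\<^sub>t z ^ m \<cdot>\<^sub>t (R z *\<^sub>t (A *\<^sub>t D)) *\<^sub>t A ^\<^sub>t q)
      (?L +\<^sub>t 0 ^ m \<cdot>\<^sub>t D *\<^sub>t A ^\<^sub>t q) (at 0)"
    by (intro lim_add nilpotent_part[OF assms] lim_mult[OF lim_smult[OF _ core_part] lim_const] tendsto_intros)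
      simp_all
  from t_tendsto_transform[OF this eq]
  have lim: "t_tendsto (\<lambda>z. z ^ m \<cdot>\<^sub>t R z *\<^sub>t A ^\<^sub>t q) (?L +\<^sub>t 0 ^ m \<cdot>\<^sub>t D *\<^sub>t A ^\<^sub>t q) (at 0)" .
  have "?L +\<^sub>t 0 ^ m \<cdot>\<^sub>t D *\<^sub>t A ^\<^sub>t q =
      (if m > 0 then (- 1) ^ (m + 1) \<cdot>\<^sub>t E *\<^sub>t A ^\<^sub>t (m + q - 1) else D *\<^sub>t A ^\<^sub>t q)"
    by (rule tensor_eqI[of _ n n p]) (simp_all add: t_add_index[of _ n n p] t_smult_index[of _ n n p] del: t_pow.simps)
  thus ?thesis using lim by (rule subst)
qed

text \<open>
  If \<open>m + q\<close> were below the index, let \<open>m'\<close> be the exponent with \<open>m' + q = t_index A\<close>. Multiplying the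
  convergent family by \<open>z ^ (m' - m)\<close> makes it tend to \<open>0\<close>, whereas \<open>limit_formula\<close> gives the limit
  \<open>E *\<^sub>t A ^\<^sub>t (t_index A - 1)\<close> up to sign. If that tensor is zero, then \<open>A ^\<^sub>t (t_index A - 1)\<close> factors
  through the next power, contradicting the minimality of the index.
\<close>

lemma index_le_if_limit:
  assumes L: "L \<in> C" and lim: "t_tendsto (\<lambda>z. z ^ m \<cdot>\<^sub>t R z *\<^sub>t A ^\<^sub>t q) L (at 0)"
  shows "t_index A \<le> m + q"
proof (rule ccontr)
  assume neg: "\<not> t_index A \<le> m + q"
  define m' k where "m' = t_index A - q" and "k = t_index A - 1"
  have m': "m' > m" "m' + q = t_index A" "m' + q - 1 = k" and k: "Suc k = t_index A"
    using neg by (auto simp: m'_def k_def)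
  have L': "t_tendsto (\<lambda>z. z ^ m' \<cdot>\<^sub>t R z *\<^sub>t A ^\<^sub>t q) ((- 1) ^ (m' + 1) \<cdot>\<^sub>t E *\<^sub>t A ^\<^sub>t k) (at 0)"
    using limit_formula[of m' q] m' by simp
  have "t_tendsto (\<lambda>z. z ^ (m' - m) \<cdot>\<^sub>t (z ^ m \<cdot>\<^sub>t R z *\<^sub>t A ^\<^sub>t q)) (0 ^ (m' - m) \<cdot>\<^sub>t L) (at 0)"
    by (intro t_tendsto_smult[OF _ lim L p] tendsto_intros)
  moreover have eq: "\<forall>\<^sub>F z in at 0. z ^ m' \<cdot>\<^sub>t R z *\<^sub>t A ^\<^sub>t q = z ^ (m' - m) \<cdot>\<^sub>t (z ^ m \<cdot>\<^sub>t R z *\<^sub>t A ^\<^sub>t q)"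
    using resolvent_left_inverse
    by eventually_elim (use m' in \<open>simp add: t_smult_smult power_add[symmetric]\<close>)
  ultimately have "t_tendsto (\<lambda>z. z ^ m' \<cdot>\<^sub>t R z *\<^sub>t A ^\<^sub>t q) (0 \<cdot>\<^sub>t L) (at 0)"
    using t_tendsto_transform[OF _ eq] m'(1) by (simp add: power_0_left)
  hence "(- 1) ^ (m' + 1) \<cdot>\<^sub>t E *\<^sub>t A ^\<^sub>t k = 0 \<cdot>\<^sub>t L"
    using t_tendsto_unique[OF L' _ _ _ p, of "0 \<cdot>\<^sub>t L" n n] L by simp
  hence "(- 1) ^ (m' + 1) \<cdot>\<^sub>t ((- 1) ^ (m' + 1) \<cdot>\<^sub>t E *\<^sub>t A ^\<^sub>t k) = (- 1) ^ (m' + 1) \<cdot>\<^sub>t (0 \<cdot>\<^sub>t L)" by simp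
  hence E0: "E *\<^sub>t A ^\<^sub>t k = 0 \<cdot>\<^sub>t L"
    by (simp add: t_smult_smult t_smult_one flip: power_add mult_2)
  have "A ^\<^sub>t k = E *\<^sub>t A ^\<^sub>t k +\<^sub>t A *\<^sub>t D *\<^sub>t A ^\<^sub>t k" by (rule core_nilpotent_split) simp
  also have "\<dots> = A *\<^sub>t D *\<^sub>t A ^\<^sub>t k"
    unfolding E0 using L by (intro tensor_eqI[of _ n n p]) (simp_all add: t_add_index[of _ n n p] t_smult_index[of _ n n p])
  also have "\<dots> = A ^\<^sub>t Suc k *\<^sub>t D" unfolding pow_D_A[symmetric] by (simp add: mult_assoc)
  finally have "t_index A \<le> k" by (rule t_index_le[OF A p D_closed])
  thus False using k by simp
qed

end

theorem theorem18:
  fixes A :: "complex tensor" and n p k m q :: nat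
  assumes "n > 0" and "p > 0"
    and "A \<in> carrier_tensor n n p"
    and "t_index A = k"
  shows "((\<exists>L \<in> carrier_tensor n n p.
            t_tendsto (\<lambda>z. z ^ m \<cdot>\<^sub>t t_inv (A +\<^sub>t z \<cdot>\<^sub>t t_one n p) *\<^sub>t A ^\<^sub>t q) L (at 0))
          \<longleftrightarrow> m + q \<ge> k) \<and>
         (m + q \<ge> k \<longrightarrow>
            t_tendsto (\<lambda>z. z ^ m \<cdot>\<^sub>t t_inv (A +\<^sub>t z \<cdot>\<^sub>t t_one n p) *\<^sub>t A ^\<^sub>t q)
              (if m > 0
               then (-1) ^ (m + 1) \<cdot>\<^sub>t (t_one n p -\<^sub>t A *\<^sub>t t_drazin A) *\<^sub>t A ^\<^sub>t (m + q - 1)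
               else t_drazin A *\<^sub>t A ^\<^sub>t q)
              (at 0))"
proof -
  interpret t_drazin_splitting A n p using assms by unfold_locales
  let ?f = "\<lambda>z. z ^ m \<cdot>\<^sub>t R z *\<^sub>t A ^\<^sub>t q"
  let ?L = "if m > 0 then (- 1) ^ (m + 1) \<cdot>\<^sub>t E *\<^sub>t A ^\<^sub>t (m + q - 1) else D *\<^sub>t A ^\<^sub>t q"
  have "?L \<in> C" by simp
  hence "(\<exists>L \<in> C. t_tendsto ?f L (at 0)) \<longleftrightarrow> k \<le> m + q"
    using limit_formula[of m q] index_le_if_limit[of _ m q] assms(4) by blast
  thus ?thesis
    using limit_formula[of m q] assms(4) unfolding R_def E_def D_def by blast
qed

end
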